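(* Let $\alpha,\beta>-1$ with $|\beta|\leq 1/2$, and let $\theta_{j,k}^{(\alpha,\beta)}$ ($j\ge 1$, $1\le k\le j$) denote the angular zeros of the Jacobi polynomials, i.e. $0<\theta_{j,1}^{(\alpha,\beta)}<\cdots<\theta_{j,j}^{(\alpha,\beta)}<\pi$ and $P_j^{(\alpha,\beta)}(\cos\theta_{j,k}^{(\alpha,\beta)})=0$. Set $\rho=\frac{\alpha+\beta+1}{2}$, \[ \Phi_{\alpha,\beta}(x)=\frac{1-4\alpha^2}{16}\,\frac{1-x\cot x}{\sin^2x}+\frac{1-4\beta^2}{16}\,\frac{1+x\tan x}{\cos^2x},\qquad 0<x<\frac{\pi}{2}, \] and \[ m_{\alpha,\beta}=\inf_{0<x<\pi/2}\Phi_{\alpha,\beta}(x). \] Then $m_{\alpha,\beta}$ is finite. Define \[ \sigma_\uparrow(\alpha,\beta)=\rho-\frac{(-m_{\alpha,\beta})_+}{1+\rho}, \] where $s_+=\max\{s,0\}$. If $-1<\sigma\leq\sigma_\uparrow(\alpha,\beta)$, then \[ (n+\sigma)\,\theta_{n,k}^{(\alpha,\beta)}\leq(n+1+\sigma)\,\theta_{n+1,k}^{(\alpha,\beta)} \] for every integer $n\geq1$ and $1\leq k\leq n$. Equality holds for some such $n$ and $k$ if and only if $|\alpha|=|\beta|=\frac12$ and $\sigma=\rho$. In that case, equality holds for every integer $n\geq1$ and $1\leq k\leq n$.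
   Context: $P_n^{(\alpha,\beta)}$ denotes the Jacobi polynomial of degree $n$ (orthogonal on $(-1,1)$ with respect to the weight $(1-x)^\alpha(1+x)^\beta$), normalised by $P_n^{(\alpha,\beta)}(1)=(\alpha+1)_n/n!$. For $\alpha,\beta>-1$ its $n$ zeros are simple and lie in $(-1,1)$, so the angles $\theta_{n,k}^{(\alpha,\beta)}$ are well defined. *)

theory Defs
  imports "HOL-Analysis.Analysis" "HOL-Computational_Algebra.Polynomial"
begin

(* Orthogonality to all polynomials of smaller degree; for a sequence with degree P_n = n this is
   the same as pairwise orthogonality. At x = -1, 1 the weight may blow up, so the integral runs
   over the open interval; it converges absolutely for \<alpha>, \<beta> > -1. *)
definition is_jacobi_poly :: "real \<Rightarrow> real \<Rightarrow> nat \<Rightarrow> real poly \<Rightarrow> bool" where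
  "is_jacobi_poly \<alpha> \<beta> n p \<longleftrightarrow>
     degree p = n \<and>
     (\<forall>q. degree q < n \<longrightarrow>
        (LBINT x:{-1<..<1}. (1 - x) powr \<alpha> * (1 + x) powr \<beta> * (poly p x * poly q x)) = 0) \<and>
     poly p 1 = pochhammer (\<alpha> + 1) n / fact n"

(* For \<alpha>, \<beta> > -1 exactly one polynomial satisfies the predicate; outside this range the
   definition carries no meaning. *)
definition jacobi_poly :: "real \<Rightarrow> real \<Rightarrow> nat \<Rightarrow> real poly" where
  "jacobi_poly \<alpha> \<beta> n = (THE p. is_jacobi_poly \<alpha> \<beta> n p)"

definition rho :: "real \<Rightarrow> real \<Rightarrow> real" where
  "rho \<alpha> \<beta> = (\<alpha> + \<beta> + 1) / 2"

definition Phi :: "real \<Rightarrow> real \<Rightarrow> real \<Rightarrow> real" where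
  "Phi \<alpha> \<beta> x =
     (1 - 4 * \<alpha>\<^sup>2) / 16 * ((1 - x * cot x) / (sin x)\<^sup>2) +
     (1 - 4 * \<beta>\<^sup>2) / 16 * ((1 + x * tan x) / (cos x)\<^sup>2)"

(* The real infimum is meaningful only when Phi is bounded below on the interval. *)
definition m_inf :: "real \<Rightarrow> real \<Rightarrow> real" where
  "m_inf \<alpha> \<beta> = (INF x\<in>{0<..<pi/2}. Phi \<alpha> \<beta> x)"

definition sigma_up :: "real \<Rightarrow> real \<Rightarrow> real" where
  "sigma_up \<alpha> \<beta> = rho \<alpha> \<beta> - max (- m_inf \<alpha> \<beta>) 0 / (1 + rho \<alpha> \<beta>)"

end

theory Submission
  imports Defs "HOL-Real_Asymp.Real_Asymp"
begin

text \<open>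
  Put \<open>x = \<theta> / 2\<close>. The function \<open>u\<^sub>n x = sin x powr (\<alpha> + 1/2) * cos x powr (\<beta> + 1/2) * P\<^sub>n (cos (2 * x))\<close>
  has the same zeros on \<open>(0, pi/2)\<close> as \<open>P\<^sub>n (cos (2 * x))\<close>, and the Jacobi equation turns into
  \<open>u'' + 4 * ((n + \<rho>)\<^sup>2 + A / (sin x)\<^sup>2 + B / (cos x)\<^sup>2) * u = 0\<close> with \<open>A = (1 - 4 * \<alpha>\<^sup>2) / 16\<close> and
  \<open>B = (1 - 4 * \<beta>\<^sup>2) / 16\<close>. Stretching the variable by \<open>s = n + \<sigma>\<close> gives functions of \<open>t = s * x\<close>
  whose zeros are \<open>(n + \<sigma>) * \<theta> n k / 2\<close>, so the claim is that the \<open>k\<close>-th zero does not decrease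
  when \<open>n\<close> grows by one. By Sturm comparison it suffices that the coefficient of the stretched
  equation decreases in \<open>s\<close> for fixed \<open>t\<close>. With \<open>\<delta> = \<rho> - \<sigma>\<close>, its \<open>s\<close>-derivative is
  \<open>- 8 / s^3 * (\<delta> * (s + \<delta>) + \<Phi> (t / s))\<close> (lemma \<open>scaled_coeff_deriv\<close>); this is
  where \<open>\<Phi>\<close> comes from, and the bound \<open>\<sigma> \<le> \<sigma>\<^sub>\<up>\<close> is what makes the bracket nonnegative for
  all \<open>s \<ge> 1 + \<sigma>\<close>, because there \<open>s + \<delta> \<ge> 1 + \<rho>\<close>.

  The bracket is even positive for \<open>s > 1 + \<sigma>\<close> unless \<open>\<delta> = A = B = 0\<close> (lemma \<open>frequency_gain_pos\<close>). For
  \<open>\<delta> > 0\<close> this is the strict growth of \<open>\<delta> * (s + \<delta>)\<close>. For \<open>\<delta> = 0\<close> it says that \<open>\<Phi> \<ge> 0\<close> forces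
  \<open>\<Phi> > 0\<close>: the delicate case \<open>A < 0\<close> is settled by the limit \<open>A / 3 + B \<ge> 0\<close> of \<open>\<Phi>\<close> at 0, since
  the function multiplying \<open>B\<close> is more than three times the one multiplying \<open>A\<close> (lemma
  \<open>tan_part_gt\<close>). So Sturm comparison yields strict inequalities outside the exceptional case. In
  the exceptional case both stretched equations are \<open>u'' + 4 * u = 0\<close>, and the zeros coincide.

  The left end of the interval is singular, and for \<open>\<alpha> < -1/2\<close> the functions \<open>u\<close> are unbounded
  there. What the comparison needs is only that the Wronskian of the two stretched functions
  tends to 0 (lemma \<open>wronskian_limit\<close>): its two factors \<open>sin powr (\<alpha> + 1/2)\<close> contribute
  \<open>t powr (2 * \<alpha> + 1)\<close>, and the remaining factor is of order \<open>t\<close> because the singular parts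
  \<open>(\<alpha> + 1/2) / t\<close> of the two logarithmic derivatives do not depend on the stretching and cancel.
  Since \<open>\<alpha> > -1\<close>, the product vanishes at 0.

  The Jacobi polynomial is given by orthogonality, so it has first to be identified with the
  hypergeometric polynomial, for which the differential equation can be read off the coefficients
  (lemma \<open>jacobi_poly_eq_explicit\<close>).
\<close>

section \<open>Integrability of the Jacobi weight\<close>

definition jacobi_weight :: "real \<Rightarrow> real \<Rightarrow> real \<Rightarrow> real" where
  "jacobi_weight \<alpha> \<beta> x = (1 - x) powr \<alpha> * (1 + x) powr \<beta>"

text \<open>The substitution \<open>x = 1 - 2 * t\<close> turns the weight into the integrand of the Beta function.\<close>

lemma jacobi_weight_integrable:
  assumes "\<alpha> > -1" "\<beta> > -1"
  shows "set_integrable lborel {-1<..<1} (jacobi_weight \<alpha> \<beta>)"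
proof -
  have "set_integrable lborel {0<..<1} (\<lambda>t::real. t powr \<alpha> * (1 - t) powr \<beta>)"
    using set_integrable_subset[OF integrable_Beta[of "\<alpha> + 1" "\<beta> + 1"], of "{0<..<1}"] assms
    by (auto simp: greaterThanLessThan_subseteq_atLeastAtMost_iff)
  then have "integrable lborel (\<lambda>t::real. 2 powr \<alpha> * 2 powr \<beta> *
      (indicator {0<..<1} t *\<^sub>R (t powr \<alpha> * (1 - t) powr \<beta>)))"
    unfolding set_integrable_def by (rule integrable_mult_right)
  also have "(\<lambda>t::real. 2 powr \<alpha> * 2 powr \<beta> *
      (indicator {0<..<1} t *\<^sub>R (t powr \<alpha> * (1 - t) powr \<beta>))) =
      (\<lambda>t. indicator {-1<..<1} (1 + (-2) * t) *\<^sub>R jacobi_weight \<alpha> \<beta> (1 + (-2) * t))"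
  proof
    fix t :: real
    have "2 - 2 * t = 2 * (1 - t)" by simp
    then have "(2 - 2 * t) powr \<beta> = 2 powr \<beta> * (1 - t) powr \<beta>" if "t < 1"
      using that powr_mult[of 2 "1 - t" \<beta>] by simp
    then show "2 powr \<alpha> * 2 powr \<beta> * (indicator {0<..<1} t *\<^sub>R (t powr \<alpha> * (1 - t) powr \<beta>)) =
      indicator {-1<..<1} (1 + (-2) * t) *\<^sub>R jacobi_weight \<alpha> \<beta> (1 + (-2) * t)"
      by (auto simp: jacobi_weight_def indicator_def powr_mult)
  qed
  finally show ?thesis
    unfolding set_integrable_def
    by (subst (asm) lborel_integrable_real_affine_iff) auto
qed

lemma jacobi_weight_poly_integrable:
  assumes "\<alpha> > -1" "\<beta> > -1"
  shows "set_integrable lborel {-1<..<1} (\<lambda>x. jacobi_weight \<alpha> \<beta> x * poly p x)"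
proof -
  have "compact ((\<lambda>x. poly p x) ` {-1..1})"
    by (intro compact_continuous_image continuous_intros) auto
  then obtain C where C: "\<And>x. x \<in> {-1..1} \<Longrightarrow> \<bar>poly p x\<bar> \<le> C"
    using compact_imp_bounded bounded_iff by (metis imageI real_norm_def)
  have "set_integrable lborel {-1<..<1} (\<lambda>x. C * jacobi_weight \<alpha> \<beta> x)"
    using jacobi_weight_integrable[OF assms] by (intro set_integrable_mult_right)
  then show ?thesis
  proof (rule set_integrable_bound)
    show "set_borel_measurable lborel {-1<..<1} (\<lambda>x. jacobi_weight \<alpha> \<beta> x * poly p x)"
      unfolding set_borel_measurable_def jacobi_weight_def
      by (auto intro!: borel_measurable_times borel_measurable_scaleR
          borel_measurable_continuous_onI[of "poly p"] continuous_intros)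
    show "AE x in lborel. x \<in> {-1<..<1} \<longrightarrow>
        norm (jacobi_weight \<alpha> \<beta> x * poly p x) \<le> norm (C * jacobi_weight \<alpha> \<beta> x)"
    proof (intro AE_I2 impI)
      fix x :: real assume "x \<in> {-1<..<1}"
      then have "\<bar>poly p x\<bar> \<le> C" using C[of x] by auto
      then have "\<bar>jacobi_weight \<alpha> \<beta> x\<bar> * \<bar>poly p x\<bar> \<le> \<bar>jacobi_weight \<alpha> \<beta> x\<bar> * \<bar>C\<bar>"
        by (intro mult_left_mono) auto
      then show "norm (jacobi_weight \<alpha> \<beta> x * poly p x) \<le> norm (C * jacobi_weight \<alpha> \<beta> x)"
        by (simp add: abs_mult mult.commute)
    qed
  qed
qed

section \<open>Symmetry of the Jacobi operator\<close>

definition jacobi_form :: "real \<Rightarrow> real \<Rightarrow> real poly \<Rightarrow> real" where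
  "jacobi_form \<alpha> \<beta> p = (LBINT x:{-1<..<1}. jacobi_weight \<alpha> \<beta> x * poly p x)"

lemma jacobi_form_add:
  assumes "\<alpha> > -1" "\<beta> > -1"
  shows "jacobi_form \<alpha> \<beta> (p + q) = jacobi_form \<alpha> \<beta> p + jacobi_form \<alpha> \<beta> q"
  unfolding jacobi_form_def
  by (simp add: distrib_left set_integral_add jacobi_weight_poly_integrable[OF assms])

lemma jacobi_form_smult: "jacobi_form \<alpha> \<beta> (smult c p) = c * jacobi_form \<alpha> \<beta> p"
  unfolding jacobi_form_def by (simp add: mult.left_commute)

lemma jacobi_form_diff:
  assumes "\<alpha> > -1" "\<beta> > -1"
  shows "jacobi_form \<alpha> \<beta> (p - q) = jacobi_form \<alpha> \<beta> p - jacobi_form \<alpha> \<beta> q"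
  using jacobi_form_add[OF assms, of p "smult (-1) q"] jacobi_form_smult[of \<alpha> \<beta> "-1" q] by simp

text \<open>The weight times \<open>jacobi_div \<alpha> \<beta> r\<close> is the derivative of
  \<open>(1 - x) powr (\<alpha> + 1) * (1 + x) powr (\<beta> + 1) * r x\<close>.\<close>

definition jacobi_div :: "real \<Rightarrow> real \<Rightarrow> real poly \<Rightarrow> real poly" where
  "jacobi_div \<alpha> \<beta> r = [:\<beta> - \<alpha>, -(\<alpha> + \<beta> + 2):] * r + [:1, 0, -1:] * pderiv r"

text \<open>The integrand has the antiderivative above, which vanishes at both ends because
  \<open>\<alpha> + 1\<close> and \<open>\<beta> + 1\<close> are positive.\<close>

lemma jacobi_form_div:
  assumes "\<alpha> > -1" "\<beta> > -1"
  shows "jacobi_form \<alpha> \<beta> (jacobi_div \<alpha> \<beta> r) = 0"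
proof -
  let ?F = "\<lambda>x. (1 - x) powr (\<alpha> + 1) * (1 + x) powr (\<beta> + 1) * poly r x"
  let ?f = "\<lambda>x. jacobi_weight \<alpha> \<beta> x * poly (jacobi_div \<alpha> \<beta> r) x"
  have "(LBINT x=ereal (-1)..ereal 1. ?f x) = 0 - 0"
  proof (rule interval_integral_FTC_integrable[where F = ?F])
    fix x assume "ereal (-1) < ereal x" "ereal x < ereal 1"
    then have x: "-1 < x" "x < 1" by auto
    have "((\<lambda>x. (1 - x) powr (\<alpha> + 1)) has_real_derivative
          (\<alpha> + 1) * (1 - x) powr (\<alpha> + 1 - of_nat 1) * (-1)) (at x)"
      "((\<lambda>x. (1 + x) powr (\<beta> + 1)) has_real_derivative
          (\<beta> + 1) * (1 + x) powr (\<beta> + 1 - of_nat 1) * 1) (at x)"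
      using x by (intro DERIV_fun_powr; auto intro!: derivative_eq_intros)+
    note d = DERIV_mult[OF DERIV_mult[OF this] poly_DERIV[of r x]]
    have e: "(1 - x) powr (\<alpha> + 1) = (1 - x) * (1 - x) powr \<alpha>"
      "(1 + x) powr (\<beta> + 1) = (1 + x) * (1 + x) powr \<beta>"
      using x by (simp_all add: powr_add)
    have "(?F has_real_derivative ?f x) (at x)"
      by (rule DERIV_cong[OF d]) (simp add: jacobi_weight_def jacobi_div_def e, simp add: algebra_simps)
    then show "(?F has_vector_derivative ?f x) (at x)"
      by (simp only: has_real_derivative_iff_has_vector_derivative)
    show "isCont ?f x"
      unfolding jacobi_weight_def using x by (intro continuous_intros) auto
  next
    show "set_integrable lborel (einterval (ereal (-1)) (ereal 1)) ?f"
      using jacobi_weight_poly_integrable[OF assms] by simp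
  next
    have "(?F \<longlongrightarrow> ?F (-1)) (at (-1) within {-1..})"
      using assms by (intro tendsto_intros tendsto_powr') (auto simp: eventually_at_filter)
    then have "(?F \<longlongrightarrow> 0) (at_right (-1))"
      using assms by (auto intro: tendsto_within_subset)
    then show "((?F \<circ> real_of_ereal) \<longlongrightarrow> 0) (at_right (ereal (-1)))"
      by (simp only: ereal_tendsto_simps)
    have "(?F \<longlongrightarrow> ?F 1) (at 1 within {..1})"
      using assms by (intro tendsto_intros tendsto_powr') (auto simp: eventually_at_filter)
    then have "(?F \<longlongrightarrow> 0) (at_left 1)"
      using assms by (auto intro: tendsto_within_subset)
    then show "((?F \<circ> real_of_ereal) \<longlongrightarrow> 0) (at_left (ereal 1))"
      by (simp only: ereal_tendsto_simps)
  qed simp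
  then show ?thesis
    by (simp add: jacobi_form_def interval_integral_Ioo)
qed

text \<open>This is the operator \<open>(1 - x\<^sup>2) * p'' + (\<beta> - \<alpha> - (\<alpha> + \<beta> + 2) * x) * p'\<close> in divergence form.\<close>

definition jacobi_op :: "real \<Rightarrow> real \<Rightarrow> real poly \<Rightarrow> real poly" where
  "jacobi_op \<alpha> \<beta> p = jacobi_div \<alpha> \<beta> (pderiv p)"

text \<open>The terms with \<open>(1 - x\<^sup>2) * p' * q'\<close> cancel, so that the difference of the two integrands is a
  difference of divergences.\<close>

lemma jacobi_op_symmetric:
  assumes "\<alpha> > -1" "\<beta> > -1"
  shows "jacobi_form \<alpha> \<beta> (q * jacobi_op \<alpha> \<beta> p) = jacobi_form \<alpha> \<beta> (p * jacobi_op \<alpha> \<beta> q)"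
proof -
  have "q * jacobi_op \<alpha> \<beta> p - p * jacobi_op \<alpha> \<beta> q =
      jacobi_div \<alpha> \<beta> (pderiv p * q) - jacobi_div \<alpha> \<beta> (pderiv q * p)"
    unfolding jacobi_op_def jacobi_div_def pderiv_mult by algebra
  then show ?thesis
    using jacobi_form_div[OF assms] jacobi_form_diff[OF assms]
    by (metis eq_iff_diff_eq_0 diff_zero)
qed

definition jacobi_ev :: "real \<Rightarrow> real \<Rightarrow> nat \<Rightarrow> real" where
  "jacobi_ev \<alpha> \<beta> n = real n * (real n + \<alpha> + \<beta> + 1)"

text \<open>The difference of two eigenvalues has the factor \<open>m + n + \<alpha> + \<beta> + 1\<close>, which is positive since
  \<open>m + n \<ge> 1\<close> and \<open>\<alpha> + \<beta> > -2\<close>.\<close>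

lemma jacobi_ev_inj:
  assumes "\<alpha> > -1" "\<beta> > -1" "m \<noteq> n"
  shows "jacobi_ev \<alpha> \<beta> m \<noteq> jacobi_ev \<alpha> \<beta> n"
proof
  assume "jacobi_ev \<alpha> \<beta> m = jacobi_ev \<alpha> \<beta> n"
  then have "(real m - real n) * (real m + real n + \<alpha> + \<beta> + 1) = 0"
    unfolding jacobi_ev_def by (simp add: algebra_simps)
  moreover have "real m + real n \<ge> 1" using assms(3) by (cases m; cases n) auto
  ultimately show False using assms by auto
qed

lemma jacobi_eigen_orthogonal:
  assumes "\<alpha> > -1" "\<beta> > -1" "m \<noteq> n"
    and "jacobi_op \<alpha> \<beta> p = smult (- jacobi_ev \<alpha> \<beta> n) p"
    and "jacobi_op \<alpha> \<beta> q = smult (- jacobi_ev \<alpha> \<beta> m) q"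
  shows "jacobi_form \<alpha> \<beta> (p * q) = 0"
proof -
  have "- jacobi_ev \<alpha> \<beta> n * jacobi_form \<alpha> \<beta> (p * q) = - jacobi_ev \<alpha> \<beta> m * jacobi_form \<alpha> \<beta> (p * q)"
    using jacobi_op_symmetric[OF assms(1,2), of q p] assms(4,5)
    by (simp only: mult_smult_right jacobi_form_smult mult.commute[of q p])
  then show ?thesis using jacobi_ev_inj[OF assms(1-3)] by simp
qed

section \<open>The hypergeometric form of the Jacobi polynomials\<close>

text \<open>These are the coefficients of the hypergeometric series
  \<open>F (- n, n + \<alpha> + \<beta> + 1; \<alpha> + 1; y)\<close>, scaled to the value prescribed at \<open>y = 0\<close>, that is, at
  \<open>x = 1 - 2 * y = 1\<close>. The factor \<open>k - n\<close> ends the series.\<close>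

fun jacobi_coeff :: "real \<Rightarrow> real \<Rightarrow> nat \<Rightarrow> nat \<Rightarrow> real" where
  "jacobi_coeff \<alpha> \<beta> n 0 = pochhammer (\<alpha> + 1) n / fact n"
| "jacobi_coeff \<alpha> \<beta> n (Suc k) = jacobi_coeff \<alpha> \<beta> n k *
     ((real k - real n) * (real k + real n + \<alpha> + \<beta> + 1)) / ((real k + 1) * (real k + \<alpha> + 1))"

lemma jacobi_coeff_eq_0: "k > n \<Longrightarrow> jacobi_coeff \<alpha> \<beta> n k = 0"
proof (induction k)
  case (Suc k)
  then show ?case by (cases "k = n") auto
qed simp

text \<open>The step from \<open>k\<close> to \<open>k + 1\<close> is taken only for \<open>k < n\<close>, so \<open>n \<ge> 1\<close> and the factor
  \<open>k + n + \<alpha> + \<beta> + 1\<close> is positive.\<close>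

lemma jacobi_coeff_nonzero:
  assumes "\<alpha> > -1" "\<beta> > -1"
  shows "k \<le> n \<Longrightarrow> jacobi_coeff \<alpha> \<beta> n k \<noteq> 0"
proof (induction k)
  case 0
  then show ?case using assms pochhammer_pos[of "\<alpha> + 1" n] by simp
next
  case (Suc k)
  have "real n \<ge> 1" using Suc.prems by simp
  then show ?case using Suc assms by auto
qed

text \<open>The Jacobi polynomial in the variable \<open>y = (1 - x) / 2\<close>. For \<open>x = cos \<theta>\<close> this is
  \<open>y = (sin (\<theta> / 2))\<^sup>2\<close>.\<close>

definition jacobi_y :: "real \<Rightarrow> real \<Rightarrow> nat \<Rightarrow> real poly" where
  "jacobi_y \<alpha> \<beta> n = (\<Sum>k\<le>n. monom (jacobi_coeff \<alpha> \<beta> n k) k)"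

lemma coeff_jacobi_y: "coeff (jacobi_y \<alpha> \<beta> n) k = jacobi_coeff \<alpha> \<beta> n k"
  unfolding jacobi_y_def coeff_sum coeff_monom
  by (cases "k \<le> n") (simp_all add: jacobi_coeff_eq_0 sum.delta)

lemma degree_jacobi_y:
  assumes "\<alpha> > -1" "\<beta> > -1"
  shows "degree (jacobi_y \<alpha> \<beta> n) = n"
  using jacobi_coeff_nonzero[OF assms, of n n]
  by (intro antisym degree_le le_degree) (auto simp: coeff_jacobi_y jacobi_coeff_eq_0)

text \<open>Comparing coefficients of \<open>y ^ k\<close> gives exactly the recursion that defines \<open>jacobi_coeff\<close>.\<close>

lemma jacobi_y_ode:
  assumes "\<alpha> > -1" "\<beta> > -1"
  shows "[:0, 1, -1:] * pderiv (pderiv (jacobi_y \<alpha> \<beta> n)) +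
     [:\<alpha> + 1, -(\<alpha> + \<beta> + 2):] * pderiv (jacobi_y \<alpha> \<beta> n) =
     smult (- jacobi_ev \<alpha> \<beta> n) (jacobi_y \<alpha> \<beta> n)" (is "?L = ?R")
proof (rule poly_eqI)
  fix k
  have nz: "(real k + 1) * (real k + \<alpha> + 1) \<noteq> 0" using assms by simp
  have rec: "(real k + 1) * (real k + \<alpha> + 1) * jacobi_coeff \<alpha> \<beta> n (Suc k) =
     jacobi_coeff \<alpha> \<beta> n k * ((real k - real n) * (real k + real n + \<alpha> + \<beta> + 1))"
    by (simp only: jacobi_coeff.simps times_divide_eq_right nonzero_mult_div_cancel_left[OF nz])
  show "coeff ?L k = coeff ?R k"
  proof (cases k)
    case 0
    then show ?thesis using rec
      by (simp add: coeff_pderiv coeff_jacobi_y jacobi_ev_def algebra_simps del: jacobi_coeff.simps)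
  next
    case (Suc m)
    then show ?thesis using rec
      by (cases m) (simp_all add: coeff_pderiv coeff_jacobi_y jacobi_ev_def algebra_simps
        del: jacobi_coeff.simps)
  qed
qed

definition jacobi_explicit :: "real \<Rightarrow> real \<Rightarrow> nat \<Rightarrow> real poly" where
  "jacobi_explicit \<alpha> \<beta> n = pcompose (jacobi_y \<alpha> \<beta> n) [:1/2, -1/2:]"

lemma degree_jacobi_explicit:
  assumes "\<alpha> > -1" "\<beta> > -1"
  shows "degree (jacobi_explicit \<alpha> \<beta> n) = n"
  unfolding jacobi_explicit_def degree_pcompose by (simp add: degree_jacobi_y[OF assms])

lemma jacobi_explicit_at_1: "poly (jacobi_explicit \<alpha> \<beta> n) 1 = pochhammer (\<alpha> + 1) n / fact n"
  unfolding jacobi_explicit_def by (simp add: poly_pcompose poly_0_coeff_0 coeff_jacobi_y)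

lemma jacobi_explicit_eigen:
  assumes "\<alpha> > -1" "\<beta> > -1"
  shows "jacobi_op \<alpha> \<beta> (jacobi_explicit \<alpha> \<beta> n) =
    smult (- jacobi_ev \<alpha> \<beta> n) (jacobi_explicit \<alpha> \<beta> n)"
proof -
  let ?Q = "jacobi_y \<alpha> \<beta> n" and ?P = "jacobi_explicit \<alpha> \<beta> n"
  have "poly (jacobi_op \<alpha> \<beta> ?P) x = poly (smult (- jacobi_ev \<alpha> \<beta> n) ?P) x" for x
  proof -
    define y where "y = 1/2 - x/2"
    have x: "x = 1 - 2 * y" unfolding y_def by simp
    have d: "poly ?P x = poly ?Q y" "poly (pderiv ?P) x = - poly (pderiv ?Q) y / 2"
      "poly (pderiv (pderiv ?P)) x = poly (pderiv (pderiv ?Q)) y / 4"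
      unfolding jacobi_explicit_def pderiv_pcompose pderiv_mult y_def
      by (simp_all add: poly_pcompose pderiv_pCons)
    show ?thesis
      using arg_cong[OF jacobi_y_ode[OF assms, of n], of "\<lambda>p. poly p y"]
      unfolding jacobi_op_def jacobi_div_def
      by (simp add: d, simp add: x field_simps)
  qed
  then show ?thesis by (simp add: poly_eq_poly_eq_iff[symmetric] fun_eq_iff)
qed

lemma cancel_leading_term:
  fixes p q :: "real poly"
  assumes "degree p = degree q" "q \<noteq> 0"
  defines "r \<equiv> p - smult (lead_coeff p / lead_coeff q) q"
  shows "r = 0 \<or> degree r < degree p"
proof (rule eq_zero_or_degree_less)
  show "degree r \<le> degree p" unfolding r_def using assms(1) by (auto intro!: degree_diff_le)
  have "lead_coeff q \<noteq> 0" using assms(2) by simp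
  then show "coeff r (degree p) = 0" unfolding r_def assms(1) by simp
qed

text \<open>Subtracting a multiple of the eigenpolynomial of the same degree lowers the degree of \<open>q\<close>, and
  eigenpolynomials to different eigenvalues are orthogonal.\<close>

lemma jacobi_explicit_orthogonal:
  assumes "\<alpha> > -1" "\<beta> > -1"
  shows "degree q < n \<Longrightarrow> jacobi_form \<alpha> \<beta> (jacobi_explicit \<alpha> \<beta> n * q) = 0"
proof (induction "degree q" arbitrary: q rule: less_induct)
  case less
  let ?P = "jacobi_explicit \<alpha> \<beta>"
  let ?m = "degree q"
  define c where "c = lead_coeff q / lead_coeff (?P ?m)"
  define q' where "q' = q - smult c (?P ?m)"
  note deg = degree_jacobi_explicit[OF assms]
  have "jacobi_form \<alpha> \<beta> (?P n * q') = 0"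
  proof (cases "q' = 0")
    case True
    then show ?thesis using jacobi_form_smult[of \<alpha> \<beta> 0 0] by simp
  next
    case False
    have "?P ?m \<noteq> 0"
      using jacobi_explicit_at_1[of \<alpha> \<beta> ?m] pochhammer_pos[of "\<alpha> + 1" ?m] assms by auto
    then have "degree q' < ?m"
      using False cancel_leading_term[of q "?P ?m"] deg[of ?m] unfolding q'_def c_def by auto
    then show ?thesis using less by auto
  qed
  moreover have "jacobi_form \<alpha> \<beta> (?P n * ?P ?m) = 0"
    using less.prems jacobi_explicit_eigen[OF assms]
    by (intro jacobi_eigen_orthogonal[OF assms, of ?m n]) auto
  moreover have "?P n * q = smult c (?P n * ?P ?m) + ?P n * q'"
    unfolding q'_def by (simp add: algebra_simps)
  ultimately show ?case
    by (simp add: jacobi_form_add[OF assms] jacobi_form_smult)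
qed

lemma jacobi_form_square_eq_0:
  assumes "\<alpha> > -1" "\<beta> > -1" "jacobi_form \<alpha> \<beta> (r * r) = 0"
  shows "r = 0"
proof (rule ccontr)
  assume "r \<noteq> 0"
  let ?f = "\<lambda>x. indicator {-1<..<1} x *\<^sub>R (jacobi_weight \<alpha> \<beta> x * poly (r * r) x)"
  have "integrable lborel ?f"
    using jacobi_weight_poly_integrable[OF assms(1,2), of "r * r"]
    unfolding set_integrable_def .
  moreover have "integral\<^sup>L lborel ?f = 0"
    using assms(3) unfolding jacobi_form_def set_lebesgue_integral_def .
  moreover have "AE x in lborel. 0 \<le> ?f x"
    by (auto simp: jacobi_weight_def)
  ultimately have "AE x in lborel. ?f x = 0"
    using integral_nonneg_eq_0_iff_AE by blast
  moreover have "AE x in lborel. x \<notin> {x. poly r x = 0}"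
    using poly_roots_finite[OF \<open>r \<noteq> 0\<close>] by (intro AE_not_in finite_imp_null_set_lborel)
  ultimately have "AE x in lborel. x \<notin> {-1<..<1::real}"
    by eventually_elim (auto simp: jacobi_weight_def indicator_def split: if_splits)
  then have "emeasure lborel {-1<..<1::real} = 0"
    by (subst (asm) AE_iff_null_sets[symmetric]) auto
  then show False by simp
qed

text \<open>Uniqueness: a second candidate \<open>p\<close>, reduced by a multiple of the explicit polynomial to a
  remainder of smaller degree, leaves a remainder that is orthogonal to itself. The value at 1,
  which is nonzero, then determines the multiple.\<close>

lemma jacobi_poly_eq_explicit:
  assumes "\<alpha> > -1" "\<beta> > -1"
  shows "jacobi_poly \<alpha> \<beta> n = jacobi_explicit \<alpha> \<beta> n"
  unfolding jacobi_poly_def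
proof (rule the_equality)
  let ?P = "jacobi_explicit \<alpha> \<beta> n"
  have is_jacobi: "is_jacobi_poly \<alpha> \<beta> n p \<longleftrightarrow> degree p = n \<and>
      (\<forall>q. degree q < n \<longrightarrow> jacobi_form \<alpha> \<beta> (p * q) = 0) \<and>
      poly p 1 = pochhammer (\<alpha> + 1) n / fact n" for p
    unfolding is_jacobi_poly_def jacobi_form_def jacobi_weight_def by simp
  note P = degree_jacobi_explicit[OF assms, of n] jacobi_explicit_at_1[of \<alpha> \<beta> n]
    jacobi_explicit_orthogonal[OF assms, of _ n]
  have poch: "pochhammer (\<alpha> + 1) n / fact n \<noteq> 0"
    using pochhammer_pos[of "\<alpha> + 1" n] assms by simp
  show "is_jacobi_poly \<alpha> \<beta> n ?P"
    unfolding is_jacobi using P by auto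
  fix p assume "is_jacobi_poly \<alpha> \<beta> n p"
  then have p: "degree p = n" "poly p 1 = pochhammer (\<alpha> + 1) n / fact n"
    "\<And>q. degree q < n \<Longrightarrow> jacobi_form \<alpha> \<beta> (p * q) = 0"
    unfolding is_jacobi by auto
  define c where "c = lead_coeff p / lead_coeff ?P"
  define r where "r = p - smult c ?P"
  have "?P \<noteq> 0" using poch P(2) by auto
  then have "r = 0 \<or> degree r < n"
    using cancel_leading_term[of p ?P] p(1) P(1) unfolding r_def c_def by simp
  moreover have "r = 0" if "degree r < n"
  proof (rule jacobi_form_square_eq_0[OF assms])
    have "r * r = p * r - smult c (?P * r)" by (subst (1) r_def) (simp add: left_diff_distrib)
    then show "jacobi_form \<alpha> \<beta> (r * r) = 0"
      using that p(3) P(3) by (simp add: jacobi_form_diff[OF assms] jacobi_form_smult)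
  qed
  ultimately have "p = smult c ?P" unfolding r_def by auto
  moreover from this have "c = 1" using p(2) P(2) poch by auto
  ultimately show "p = ?P" by simp
qed

lemma jacobi_poly_cos:
  assumes "\<alpha> > -1" "\<beta> > -1"
  shows "poly (jacobi_poly \<alpha> \<beta> n) (cos t) = poly (jacobi_y \<alpha> \<beta> n) ((sin (t / 2))\<^sup>2)"
proof -
  have "1/2 - cos t / 2 = (sin (t / 2))\<^sup>2"
    using cos_double_sin[of "t / 2"] by (simp add: field_simps)
  then show ?thesis
    by (simp add: jacobi_poly_eq_explicit[OF assms] jacobi_explicit_def poly_pcompose)
qed

section \<open>Bounds and positivity of \<open>\<Phi>\<close>\<close>

text \<open>The derivatives of \<open>tan u - u\<close> and \<open>tan u ^ 3 - 3 * (tan u - u)\<close> are \<open>tan u ^ 2\<close> and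
  \<open>3 * tan u ^ 4\<close>.\<close>

lemma tan_cubic_bound:
  assumes "0 < x" "x < pi / 2"
  shows "x < tan x" "3 * (tan x - x) \<le> tan x ^ 3"
proof -
  have tan': "(tan has_real_derivative 1 + tan u ^ 2) (at u)" if "0 \<le> u" "u \<le> x" for u
  proof -
    have "cos u > 0" using that assms by (intro cos_gt_zero_pi) auto
    then show ?thesis
      using DERIV_tan[of u] tan_sec[of u] by (simp add: power_inverse)
  qed
  have "tan 0 - 0 < tan x - x"
  proof (rule DERIV_pos_imp_increasing_open[OF assms(1), where f = "\<lambda>u. tan u - u"])
    fix u assume u: "0 < u" "u < x"
    then have "tan u > 0" using assms by (intro tan_gt_zero) auto
    then show "\<exists>y. ((\<lambda>u. tan u - u) has_real_derivative y) (at u) \<and> 0 < y"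
      using u DERIV_diff[OF tan'[of u] DERIV_ident] by (intro exI[of _ "tan u ^ 2"]) auto
  next
    show "continuous_on {0..x} (\<lambda>u. tan u - u)"
      using tan' by (intro continuous_intros DERIV_continuous_on[of _ _ "\<lambda>u. 1 + tan u ^ 2"])
        (auto intro: has_field_derivative_at_within)
  qed
  then show "x < tan x" by simp
  have "tan 0 ^ 3 - 3 * (tan 0 - 0) \<le> tan x ^ 3 - 3 * (tan x - x)"
  proof (rule DERIV_nonneg_imp_nondecreasing[where f = "\<lambda>u. tan u ^ 3 - 3 * (tan u - u)"])
    fix u assume u: "0 \<le> u" "u \<le> x"
    have "((\<lambda>u. tan u ^ 3 - 3 * (tan u - u)) has_real_derivative 3 * tan u ^ 4) (at u)"
      by (rule DERIV_cong[OF DERIV_diff[OF DERIV_power[OF tan'[OF u]]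
            DERIV_cmult[OF DERIV_diff[OF tan'[OF u] DERIV_ident]]]])
        (simp add: algebra_simps power_numeral_reduce)
    then show "\<exists>y. ((\<lambda>u. tan u ^ 3 - 3 * (tan u - u)) has_real_derivative y) (at u) \<and> 0 \<le> y"
      by (intro exI[of _ "3 * tan u ^ 4"]) auto
  qed (use assms in auto)
  then show "3 * (tan x - x) \<le> tan x ^ 3" by simp
qed

lemma cot_part_bounds:
  fixes x :: real
  assumes "0 < x" "x < pi / 2"
  shows "0 < (1 - x * cot x) / (sin x)\<^sup>2" "(1 - x * cot x) / (sin x)\<^sup>2 \<le> 1"
proof -
  have s: "sin x > 0" "cos x > 0" using assms by (auto intro: sin_gt_zero_02 cos_gt_zero sin_gt_zero2)
  have "x * cos x < sin x"
    using tan_cubic_bound(1)[OF assms] s by (simp add: tan_def field_simps)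
  then show "0 < (1 - x * cot x) / (sin x)\<^sup>2"
    using s by (simp add: cot_def field_simps)
  have "sin x * cos x \<le> sin x * 1" using s(1) by (intro mult_left_mono) auto
  also have "\<dots> \<le> x" using sin_x_le_x[of x] assms(1) by simp
  finally have "sin x * cos x \<le> x" .
  then have "sin x * cos x * cos x \<le> x * cos x" using s by (intro mult_right_mono) auto
  then have "sin x * (cos x)\<^sup>2 \<le> x * cos x" by (simp add: power2_eq_square mult_ac)
  then have "sin x * (1 - (sin x)\<^sup>2) \<le> x * cos x" by (simp add: cos_squared_eq)
  then show "(1 - x * cot x) / (sin x)\<^sup>2 \<le> 1"
    using s by (simp add: cot_def field_simps power2_eq_square)
qed

text \<open>The constant 3 is best possible: at 0 the two quotients tend to 1/3 and 1. With \<open>T = tan x\<close>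
  the left-hand side is \<open>3 * (T - x) / (T ^ 3 * (cos x)\<^sup>2)\<close>, which the cubic bound compares with
  \<open>1 / (cos x)\<^sup>2\<close>.\<close>

lemma tan_part_gt:
  fixes x :: real
  assumes "0 < x" "x < pi / 2"
  shows "3 * ((1 - x * cot x) / (sin x)\<^sup>2) < (1 + x * tan x) / (cos x)\<^sup>2"
proof -
  have s: "sin x > 0" "cos x > 0" using assms by (auto intro: sin_gt_zero_02 cos_gt_zero sin_gt_zero2)
  define T where "T = tan x"
  have T: "T > 0" "sin x = T * cos x" "cot x = 1 / T"
    using s by (auto simp: T_def tan_def cot_def)
  have "3 * ((1 - x * cot x) / (sin x)\<^sup>2) = 3 * (T - x) / (T ^ 3 * (cos x)\<^sup>2)"
    using T(1) s unfolding T(2,3) by (simp add: field_simps power2_eq_square power3_eq_cube)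
  also have "\<dots> \<le> 1 / (cos x)\<^sup>2"
    using tan_cubic_bound(2)[OF assms] T(1) s unfolding T_def[symmetric]
    by (simp add: divide_simps)
  also have "\<dots> < (1 + x * T) / (cos x)\<^sup>2"
    using s T(1) assms by (intro divide_strict_right_mono) auto
  finally show ?thesis unfolding T_def .
qed

lemma Phi_bdd_below:
  assumes "\<bar>\<beta>\<bar> \<le> 1/2"
  shows "bdd_below (Phi \<alpha> \<beta> ` {0<..<pi/2})"
proof (rule bdd_belowI2)
  fix x :: real assume "x \<in> {0<..<pi/2}"
  then have x: "0 < x" "x < pi / 2" by auto
  define f g where "f = (1 - x * cot x) / (sin x)\<^sup>2" and "g = (1 + x * tan x) / (cos x)\<^sup>2"
  have fg: "0 < f" "f \<le> 1" "3 * f < g"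
    using cot_part_bounds[OF x] tan_part_gt[OF x] by (auto simp: f_def g_def)
  have "\<beta>\<^sup>2 \<le> (1/2)\<^sup>2" using assms abs_le_square_iff[of \<beta> "1/2"] by simp
  then have "0 \<le> (1 - 4 * \<beta>\<^sup>2) / 16 * g" using fg by (simp add: power2_eq_square)
  moreover have "\<bar>(1 - 4 * \<alpha>\<^sup>2) / 16 * f\<bar> \<le> \<bar>(1 - 4 * \<alpha>\<^sup>2) / 16\<bar> * 1"
    unfolding abs_mult using fg by (intro mult_left_mono) auto
  ultimately show "- \<bar>(1 - 4 * \<alpha>\<^sup>2) / 16\<bar> \<le> Phi \<alpha> \<beta> x"
    unfolding Phi_def f_def[symmetric] g_def[symmetric] by linarith
qed

lemma Phi_limit_0:
  "(Phi \<alpha> \<beta> \<longlongrightarrow> (1 - 4 * \<alpha>\<^sup>2) / 16 * (1 / 3) + (1 - 4 * \<beta>\<^sup>2) / 16 * 1) (at_right 0)"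
proof -
  have "((\<lambda>x::real. (1 - x * (cos x / sin x)) / (sin x)\<^sup>2) \<longlongrightarrow> 1 / 3) (at_right 0)"
    by real_asymp
  moreover have "((\<lambda>x::real. (1 + x * tan x) / (cos x)\<^sup>2) \<longlongrightarrow> 1) (at_right 0)"
    by real_asymp
  ultimately show ?thesis
    unfolding Phi_def[abs_def] cot_def by (rule tendsto_add[OF tendsto_mult_left tendsto_mult_left])
qed

lemma m_inf_le_Phi:
  assumes "\<bar>\<beta>\<bar> \<le> 1/2" "0 < x" "x < pi / 2"
  shows "m_inf \<alpha> \<beta> \<le> Phi \<alpha> \<beta> x"
  unfolding m_inf_def using assms by (intro cINF_lower Phi_bdd_below) auto

text \<open>Here \<open>\<Phi> = A * f + B * g\<close> with \<open>B \<ge> 0\<close>, \<open>f > 0\<close> and \<open>g > 3 * f\<close>. If \<open>A \<ge> 0\<close>, both terms are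
  nonnegative and one of them is positive. If \<open>A < 0\<close>, the limit \<open>A / 3 + B\<close> of \<open>\<Phi>\<close> at 0 is
  nonnegative, so \<open>A \<ge> - 3 * B\<close> and \<open>\<Phi> \<ge> B * (g - 3 * f)\<close>.\<close>

lemma Phi_pos:
  assumes \<beta>: "\<bar>\<beta>\<bar> \<le> 1/2" and m: "0 \<le> m_inf \<alpha> \<beta>" and x: "0 < x" "x < pi / 2"
    and ne: "\<not> (\<bar>\<alpha>\<bar> = 1/2 \<and> \<bar>\<beta>\<bar> = 1/2)"
  shows "0 < Phi \<alpha> \<beta> x"
proof -
  define A B where "A = (1 - 4 * \<alpha>\<^sup>2) / 16" and "B = (1 - 4 * \<beta>\<^sup>2) / 16"
  define f g where "f = (1 - x * cot x) / (sin x)\<^sup>2" and "g = (1 + x * tan x) / (cos x)\<^sup>2"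
  have Phi: "Phi \<alpha> \<beta> x = A * f + B * g" unfolding Phi_def A_def B_def f_def g_def ..
  have fg: "0 < f" "3 * f < g" "0 < g"
    using cot_part_bounds[OF x] tan_part_gt[OF x] unfolding f_def g_def by linarith+
  have zero: "(1 - 4 * c\<^sup>2) / 16 = 0 \<longleftrightarrow> \<bar>c\<bar> = 1/2" for c :: real
  proof -
    have "(1 - 4 * c\<^sup>2) / 16 = 0 \<longleftrightarrow> c\<^sup>2 = (1/2)\<^sup>2" by (auto simp: power2_eq_square)
    then show ?thesis unfolding power2_eq_iff by auto
  qed
  have "\<beta>\<^sup>2 \<le> (1/2)\<^sup>2" using \<beta> abs_le_square_iff[of \<beta> "1/2"] by simp
  then have B: "0 \<le> B" unfolding B_def by (simp add: power2_eq_square)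
  have AB: "A \<noteq> 0 \<or> B \<noteq> 0" using ne zero unfolding A_def B_def by blast
  show ?thesis
  proof (cases "0 \<le> A")
    case True
    then have "0 < A * f \<and> 0 \<le> B * g \<or> 0 \<le> A * f \<and> 0 < B * g" using AB B fg by auto
    then show ?thesis unfolding Phi by linarith
  next
    case False
    have "eventually (\<lambda>x. x \<in> {0<..<pi/2}) (at_right 0)"
      by (rule eventually_at_right_real) simp
    then have "eventually (\<lambda>x. 0 \<le> Phi \<alpha> \<beta> x) (at_right 0)"
      by (rule eventually_mono) (use m m_inf_le_Phi[OF \<beta>] in \<open>auto intro: order_trans\<close>)
    then have "0 \<le> A * (1 / 3) + B * 1"
      using tendsto_lowerbound[OF Phi_limit_0] unfolding A_def B_def by simp
    then have "- 3 * B \<le> A" "0 < B" using False by auto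
    have "0 < B * (g - 3 * f)" using \<open>0 < B\<close> fg by simp
    also have "\<dots> = (- 3 * B) * f + B * g" by (simp add: algebra_simps)
    also have "\<dots> \<le> A * f + B * g"
      using \<open>- 3 * B \<le> A\<close> fg by (intro add_right_mono mult_right_mono) auto
    finally show ?thesis unfolding Phi .
  qed
qed

lemma sigma_up_bounds:
  assumes "\<alpha> > -1" "\<beta> > -1" "\<bar>\<beta>\<bar> \<le> 1/2" "\<sigma> \<le> sigma_up \<alpha> \<beta>"
  shows "0 < 1 + rho \<alpha> \<beta>" "\<sigma> \<le> rho \<alpha> \<beta>"
    "max (- m_inf \<alpha> \<beta>) 0 \<le> (rho \<alpha> \<beta> - \<sigma>) * (1 + rho \<alpha> \<beta>)"
proof -
  show \<rho>: "0 < 1 + rho \<alpha> \<beta>" using assms(1,2) unfolding rho_def by (simp add: field_simps)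
  have "max (- m_inf \<alpha> \<beta>) 0 / (1 + rho \<alpha> \<beta>) \<le> rho \<alpha> \<beta> - \<sigma>"
    using assms(4) unfolding sigma_up_def by simp
  then show "max (- m_inf \<alpha> \<beta>) 0 \<le> (rho \<alpha> \<beta> - \<sigma>) * (1 + rho \<alpha> \<beta>)"
    using \<rho> by (simp add: pos_divide_le_eq)
  have "0 \<le> max (- m_inf \<alpha> \<beta>) 0 / (1 + rho \<alpha> \<beta>)" using \<rho> by (intro divide_nonneg_pos) auto
  then show "\<sigma> \<le> rho \<alpha> \<beta>"
    using \<open>max (- m_inf \<alpha> \<beta>) 0 / (1 + rho \<alpha> \<beta>) \<le> rho \<alpha> \<beta> - \<sigma>\<close> by linarith
qed

text \<open>For \<open>\<delta> > 0\<close> the hypothesis \<open>s > 1 + \<sigma>\<close>, that is \<open>s + \<delta> > 1 + \<rho>\<close>, makes the first term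
  strictly larger than \<open>- m\<close>, the least upper bound of \<open>- \<Phi>\<close>. For \<open>\<delta> = 0\<close> the bound on
  \<open>\<sigma>\<close> means \<open>m \<ge> 0\<close>.\<close>

lemma frequency_gain_pos:
  fixes \<alpha> \<beta> \<sigma> :: real
  defines "\<delta> \<equiv> rho \<alpha> \<beta> - \<sigma>"
  assumes "\<alpha> > -1" "\<beta> > -1" and \<beta>: "\<bar>\<beta>\<bar> \<le> 1/2" and \<sigma>: "\<sigma> \<le> sigma_up \<alpha> \<beta>"
    and ne: "\<not> (\<bar>\<alpha>\<bar> = 1/2 \<and> \<bar>\<beta>\<bar> = 1/2 \<and> \<sigma> = rho \<alpha> \<beta>)"
    and s: "1 + \<sigma> < s" and x: "0 < x" "x < pi / 2"
  shows "0 < \<delta> * (s + \<delta>) + Phi \<alpha> \<beta> x"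
proof (cases "\<delta> = 0")
  case True
  then have "0 \<le> m_inf \<alpha> \<beta>"
    using sigma_up_bounds(3)[OF assms(2,3) \<beta> \<sigma>] unfolding \<delta>_def by simp
  then show ?thesis using True ne Phi_pos[OF \<beta> _ x] unfolding \<delta>_def by auto
next
  case False
  then have "\<delta> * (1 + rho \<alpha> \<beta>) < \<delta> * (s + \<delta>)"
    using sigma_up_bounds(2)[OF assms(2,3) \<beta> \<sigma>] s unfolding \<delta>_def
    by (intro mult_strict_left_mono) auto
  then show ?thesis
    using sigma_up_bounds(3)[OF assms(2,3) \<beta> \<sigma>] m_inf_le_Phi[OF \<beta> x, of \<alpha>]
    unfolding \<delta>_def by linarith
qed

section \<open>Monotonicity of the coefficient in the stretching\<close>

text \<open>The coefficient \<open>G\<close> in \<open>v'' + G * v = 0\<close>, the equation of \<open>v t = u\<^sub>n (t / s)\<close>, with \<open>n + \<rho>\<close>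
  written as \<open>s + \<delta>\<close>. In this form \<open>s\<close> can vary over the reals between \<open>n + \<sigma>\<close> and
  \<open>n + 1 + \<sigma>\<close>.\<close>

definition scaled_coeff :: "real \<Rightarrow> real \<Rightarrow> real \<Rightarrow> real \<Rightarrow> real \<Rightarrow> real" where
  "scaled_coeff \<alpha> \<beta> \<delta> s t =
     4 * ((s + \<delta>)\<^sup>2 + (1 - 4 * \<alpha>\<^sup>2) / 16 / (sin (t / s))\<^sup>2 + (1 - 4 * \<beta>\<^sup>2) / 16 / (cos (t / s))\<^sup>2) / s\<^sup>2"

text \<open>In terms of \<open>x = t / s\<close>, differentiating \<open>1 / (sin x)\<^sup>2\<close> with respect to \<open>s\<close> produces
  \<open>2 * x * cot x / (s * (sin x)\<^sup>2)\<close>, and the outer factor \<open>1 / s\<^sup>2\<close> contributes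
  \<open>- 2 / (s * (sin x)\<^sup>2)\<close>. Together they make \<open>- 2 / s\<close> times the term
  \<open>(1 - x * cot x) / (sin x)\<^sup>2\<close> of \<open>\<Phi>\<close>, and the cosine term arises in the same way.\<close>

lemma scaled_coeff_deriv:
  assumes "0 < s" "0 < t" "t < s * (pi / 2)"
  shows "((\<lambda>s. scaled_coeff \<alpha> \<beta> \<delta> s t) has_real_derivative
     - (8 / s ^ 3) * (\<delta> * (s + \<delta>) + Phi \<alpha> \<beta> (t / s))) (at s)"
proof -
  define A B where "A = (1 - 4 * \<alpha>\<^sup>2) / 16" and "B = (1 - 4 * \<beta>\<^sup>2) / 16"
  define S C where "S = sin (t / s)" and "C = cos (t / s)"
  have "0 < t / s" "t / s < pi / 2" using assms by (auto simp: field_simps)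
  then have SC: "S \<noteq> 0" "C \<noteq> 0"
    unfolding S_def C_def using sin_gt_zero2 cos_gt_zero by fastforce+
  have x: "((\<lambda>s. t / s) has_real_derivative - t / s\<^sup>2) (at s)"
    using assms by (auto intro!: derivative_eq_intros simp: power2_eq_square)
  have sin2: "((\<lambda>s. A / (sin (t / s))\<^sup>2) has_real_derivative 2 * A * t * C / (s\<^sup>2 * S ^ 3)) (at s)"
    using SC assms unfolding S_def C_def
    by (auto intro!: derivative_eq_intros x simp: field_simps power2_eq_square power3_eq_cube)
  have cos2: "((\<lambda>s. B / (cos (t / s))\<^sup>2) has_real_derivative - 2 * B * t * S / (s\<^sup>2 * C ^ 3)) (at s)"
    using SC assms unfolding S_def C_def
    by (auto intro!: derivative_eq_intros x simp: field_simps power2_eq_square power3_eq_cube)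
  have sq: "((\<lambda>s. (s + \<delta>)\<^sup>2) has_real_derivative 2 * (s + \<delta>)) (at s)"
    by (auto intro!: derivative_eq_intros)
  have inv: "((\<lambda>s. 4 / s\<^sup>2) has_real_derivative - 8 / s ^ 3) (at s)"
    using assms by (auto intro!: derivative_eq_intros simp: field_simps power2_eq_square power3_eq_cube)
  have Phi: "Phi \<alpha> \<beta> (t / s) =
      A / S\<^sup>2 - A * t * C / (s * S ^ 3) + (B / C\<^sup>2 + B * t * S / (s * C ^ 3))"
    using SC assms unfolding Phi_def A_def[symmetric] B_def[symmetric] cot_def tan_def
      S_def[symmetric] C_def[symmetric]
    by (simp add: field_simps power2_eq_square power3_eq_cube)
  have "(\<lambda>s. scaled_coeff \<alpha> \<beta> \<delta> s t) =
      (\<lambda>s. 4 / s\<^sup>2 * ((s + \<delta>)\<^sup>2 + A / (sin (t / s))\<^sup>2 + B / (cos (t / s))\<^sup>2))"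
    unfolding scaled_coeff_def A_def B_def by auto
  moreover have "(\<dots> has_real_derivative
      - 8 / s ^ 3 * ((s + \<delta>)\<^sup>2 + A / S\<^sup>2 + B / C\<^sup>2) +
      (2 * (s + \<delta>) + 2 * A * t * C / (s\<^sup>2 * S ^ 3) + - 2 * B * t * S / (s\<^sup>2 * C ^ 3)) * (4 / s\<^sup>2)) (at s)"
    using DERIV_mult[OF inv DERIV_add[OF DERIV_add[OF sq sin2] cos2]]
    unfolding S_def C_def .
  moreover have "- 8 / s ^ 3 * ((s + \<delta>)\<^sup>2 + A / S\<^sup>2 + B / C\<^sup>2) +
      (2 * (s + \<delta>) + 2 * A * t * C / (s\<^sup>2 * S ^ 3) + - 2 * B * t * S / (s\<^sup>2 * C ^ 3)) * (4 / s\<^sup>2) =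
      - (8 / s ^ 3) * (\<delta> * (s + \<delta>) + Phi \<alpha> \<beta> (t / s))"
    unfolding Phi using SC assms
    by (simp add: divide_simps) (simp add: algebra_simps power_numeral_reduce)
  ultimately show ?thesis by simp
qed

lemma scaled_coeff_decreasing:
  fixes \<alpha> \<beta> \<sigma> :: real
  defines "\<delta> \<equiv> rho \<alpha> \<beta> - \<sigma>"
  assumes "\<alpha> > -1" "\<beta> > -1" "\<bar>\<beta>\<bar> \<le> 1/2" "-1 < \<sigma>" "\<sigma> \<le> sigma_up \<alpha> \<beta>"
    and "\<not> (\<bar>\<alpha>\<bar> = 1/2 \<and> \<bar>\<beta>\<bar> = 1/2 \<and> \<sigma> = rho \<alpha> \<beta>)"
    and s: "1 + \<sigma> \<le> s" and t: "0 < t" "t < s * (pi / 2)"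
  shows "scaled_coeff \<alpha> \<beta> \<delta> (s + 1) t < scaled_coeff \<alpha> \<beta> \<delta> s t"
proof (rule DERIV_neg_imp_decreasing_open[where f = "\<lambda>s. scaled_coeff \<alpha> \<beta> \<delta> s t"])
  have deriv: "((\<lambda>s. scaled_coeff \<alpha> \<beta> \<delta> s t) has_real_derivative
     - (8 / r ^ 3) * (\<delta> * (r + \<delta>) + Phi \<alpha> \<beta> (t / r))) (at r)"
    and dom: "0 < r" "t < r * (pi / 2)" if "s \<le> r" for r
  proof -
    show "0 < r" using that s assms(5) by simp
    show "t < r * (pi / 2)" using t(2) mult_right_mono[OF that pi_half_ge_zero] by linarith
    then show "((\<lambda>s. scaled_coeff \<alpha> \<beta> \<delta> s t) has_real_derivative
     - (8 / r ^ 3) * (\<delta> * (r + \<delta>) + Phi \<alpha> \<beta> (t / r))) (at r)"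
      using \<open>0 < r\<close> t(1) by (intro scaled_coeff_deriv)
  qed
  fix r assume r: "s < r" "r < s + 1"
  then have "0 < \<delta> * (r + \<delta>) + Phi \<alpha> \<beta> (t / r)"
    unfolding \<delta>_def using assms(2-7) s t dom[of r]
    by (intro frequency_gain_pos) (auto simp: field_simps)
  then show "\<exists>y. ((\<lambda>s. scaled_coeff \<alpha> \<beta> \<delta> s t) has_real_derivative y) (at r) \<and> y < 0"
    using deriv[of r] dom[of r] r
    by (intro exI[of _ "- (8 / r ^ 3) * (\<delta> * (r + \<delta>) + Phi \<alpha> \<beta> (t / r))"])
      (auto intro!: mult_neg_pos)
next
  have "isCont (\<lambda>s. scaled_coeff \<alpha> \<beta> \<delta> s t) r" if "s \<le> r" for r
  proof (rule DERIV_isCont[OF scaled_coeff_deriv])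
    show "0 < r" using that s assms(5) by simp
    show "t < r * (pi / 2)" using t(2) mult_right_mono[OF that pi_half_ge_zero] by linarith
  qed (rule t)
  then show "continuous_on {s..s + 1} (\<lambda>s. scaled_coeff \<alpha> \<beta> \<delta> s t)"
    by (intro continuous_at_imp_continuous_on) auto
qed simp

section \<open>Sturm comparison\<close>

lemma nonvanishing_constant_sign:
  fixes f :: "real \<Rightarrow> real"
  assumes "continuous_on {l<..<r} f" "\<And>t. l < t \<Longrightarrow> t < r \<Longrightarrow> f t \<noteq> 0"
  obtains e where "e = 1 \<or> e = -1" "\<And>t. l < t \<Longrightarrow> t < r \<Longrightarrow> 0 < e * f t"
proof -
  have "connected (f ` {l<..<r})" using assms(1) by (intro connected_continuous_image) auto
  moreover have "0 \<notin> f ` {l<..<r}" using assms(2) by auto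
  ultimately have same: "\<not> (a < 0 \<and> 0 < b)" if "a \<in> f ` {l<..<r}" "b \<in> f ` {l<..<r}" for a b
    using that unfolding connected_iff_interval by (meson less_imp_le)
  show thesis
  proof (cases "\<exists>t. l < t \<and> t < r \<and> 0 < f t")
    case True
    then obtain t where t: "l < t" "t < r" "0 < f t" by blast
    have "0 < 1 * f u" if "l < u" "u < r" for u
      using same[of "f u" "f t"] t that assms(2)[OF that] by auto
    then show ?thesis using that[of 1] by blast
  next
    case False
    then have "0 < - 1 * f u" if "l < u" "u < r" for u
      using assms(2)[OF that] that by force
    then show ?thesis using that[of "-1"] by blast
  qed
qed

text \<open>The Wronskian \<open>W = v * w' - v' * w\<close> has derivative \<open>(G - K) * v * w > 0\<close> between \<open>l\<close> and \<open>r\<close>. It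
  starts at a value that is at least 0: either by the limit hypothesis, or because
  \<open>W l = v l * w' l\<close> where \<open>w\<close> leaves its zero upwards. It ends at \<open>W r = v r * w' r \<le> 0\<close>,
  a contradiction.\<close>

lemma sturm_positive:
  fixes v w v' w' G K :: "real \<Rightarrow> real"
  assumes "0 \<le> l" "l < r" "r < R"
    and v: "\<And>t. 0 < t \<Longrightarrow> t < R \<Longrightarrow> (v has_real_derivative v' t) (at t)"
      "\<And>t. 0 < t \<Longrightarrow> t < R \<Longrightarrow> (v' has_real_derivative - G t * v t) (at t)"
    and w: "\<And>t. 0 < t \<Longrightarrow> t < R \<Longrightarrow> (w has_real_derivative w' t) (at t)"
      "\<And>t. 0 < t \<Longrightarrow> t < R \<Longrightarrow> (w' has_real_derivative - K t * w t) (at t)"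
    and less: "\<And>t. 0 < t \<Longrightarrow> t < R \<Longrightarrow> K t < G t"
    and W0: "((\<lambda>t. v t * w' t - v' t * w t) \<longlongrightarrow> 0) (at_right 0)"
    and l: "l = 0 \<or> w l = 0" and r: "w r = 0"
    and pos: "\<And>t. l < t \<Longrightarrow> t < r \<Longrightarrow> 0 < v t" "\<And>t. l < t \<Longrightarrow> t < r \<Longrightarrow> 0 < w t"
  shows False
proof -
  define W where "W = (\<lambda>t. v t * w' t - v' t * w t)"
  have v_r: "0 \<le> v r"
  proof (rule tendsto_lowerbound)
    have "isCont v r" using assms(1-3) by (intro DERIV_isCont[OF v(1)]) auto
    then show "(v \<longlongrightarrow> v r) (at_left r)"
      unfolding isCont_def by (auto intro: tendsto_within_subset)
    show "eventually (\<lambda>t. 0 \<le> v t) (at_left r)"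
      using eventually_at_left_real[OF \<open>l < r\<close>]
      by (rule eventually_mono) (use pos(1) in \<open>auto intro: less_imp_le\<close>)
  qed simp
  have v_l: "0 \<le> v l" if "0 < l"
  proof (rule tendsto_lowerbound)
    have "isCont v l" using assms(2,3) that by (intro DERIV_isCont[OF v(1)]) auto
    then show "(v \<longlongrightarrow> v l) (at_right l)"
      unfolding isCont_def by (auto intro: tendsto_within_subset)
    show "eventually (\<lambda>t. 0 \<le> v t) (at_right l)"
      using eventually_at_right_real[OF \<open>l < r\<close>]
      by (rule eventually_mono) (use pos(1) in \<open>auto intro: less_imp_le\<close>)
  qed simp
  have W_incr: "W c < W d" if "l < c" "c < d" "d < r" for c d
  proof (rule DERIV_pos_imp_increasing[OF \<open>c < d\<close>])
    fix t assume "c \<le> t" "t \<le> d"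
    then have t: "0 < t" "t < R" "l < t" "t < r" using that assms(1,3) by auto
    have "(W has_real_derivative (G t - K t) * (v t * w t)) (at t)"
      unfolding W_def
      by (rule DERIV_cong[OF DERIV_diff[OF DERIV_mult[OF v(1) w(2)] DERIV_mult[OF v(2) w(1)]]])
        (use t in \<open>auto simp: algebra_simps\<close>)
    then show "\<exists>y. (W has_real_derivative y) (at t) \<and> 0 < y"
      using less[of t] pos[of t] t by (intro exI[of _ "(G t - K t) * (v t * w t)"]) auto
  qed
  have W_r: "W r \<le> 0" and Wc_r: "isCont W r"
  proof -
    have r': "0 < r" using assms(1,2) by simp
    have "\<not> w' r > 0"
    proof
      assume "w' r > 0"
      then obtain d where d: "d > 0" "\<And>h. 0 < h \<Longrightarrow> h < d \<Longrightarrow> w (r - h) < w r"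
        using DERIV_pos_inc_left[OF w(1)[OF r' \<open>r < R\<close>]] by blast
      have "w (r - min (d/2) ((r - l)/2)) < 0"
        using d(2)[of "min (d/2) ((r - l)/2)"] d(1) r \<open>l < r\<close> by (auto simp: min_def split: if_splits)
      moreover have "0 < w (r - min (d/2) ((r - l)/2))"
        using d(1) \<open>l < r\<close> by (intro pos(2)) (auto simp: min_def field_simps)
      ultimately show False by simp
    qed
    then show "W r \<le> 0"
      unfolding W_def r using v_r by (simp add: mult_nonneg_nonpos)
    show "isCont W r"
      unfolding W_def using v[OF r' \<open>r < R\<close>] w[OF r' \<open>r < R\<close>]
      by (intro continuous_intros) (auto intro: DERIV_isCont)
  qed
  obtain L where L: "0 \<le> L" "(W \<longlongrightarrow> L) (at_right l)"
  proof (cases "l = 0")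
    case True
    then show ?thesis using that[of 0] W0 unfolding W_def by simp
  next
    case False
    then have l': "0 < l" "l < R" "w l = 0" using assms(1-3) l by auto
    have "\<not> w' l < 0"
    proof
      assume "w' l < 0"
      then obtain d where d: "d > 0" "\<And>h. 0 < h \<Longrightarrow> h < d \<Longrightarrow> w (l + h) < w l"
        using DERIV_neg_dec_right[OF w(1)[OF l'(1,2)]] by blast
      have "w (l + min (d/2) ((r - l)/2)) < 0"
        using d(2)[of "min (d/2) ((r - l)/2)"] d(1) l'(3) \<open>l < r\<close> by (auto simp: min_def split: if_splits)
      moreover have "0 < w (l + min (d/2) ((r - l)/2))"
        using d(1) \<open>l < r\<close> by (intro pos(2)) (auto simp: min_def field_simps)
      ultimately show False by simp
    qed
    then have "0 \<le> W l"
      unfolding W_def l'(3) using v_l[OF l'(1)] by simp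
    moreover have "isCont W l"
      unfolding W_def using v[OF l'(1,2)] w[OF l'(1,2)]
      by (intro continuous_intros) (auto intro: DERIV_isCont)
    ultimately show ?thesis
      using that[of "W l"] unfolding isCont_def by (auto intro: tendsto_within_subset)
  qed
  obtain c d where cd: "l < c" "c < d" "d < r" using \<open>l < r\<close> dense by meson
  have "L \<le> W c"
  proof (rule tendsto_upperbound[OF L(2)])
    show "eventually (\<lambda>t. W t \<le> W c) (at_right l)"
      using eventually_at_right_real[OF cd(1)]
      by (rule eventually_mono) (use cd W_incr[of _ c] in \<open>auto intro: less_imp_le\<close>)
  qed simp
  moreover have "W d \<le> W r"
  proof (rule tendsto_lowerbound)
    show "(W \<longlongrightarrow> W r) (at_left r)"
      using Wc_r unfolding isCont_def by (auto intro: tendsto_within_subset)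
    show "eventually (\<lambda>t. W d \<le> W t) (at_left r)"
      using eventually_at_left_real[OF cd(3)]
      by (rule eventually_mono) (use cd W_incr[of d] in \<open>auto intro: less_imp_le\<close>)
  qed simp
  ultimately show False using L(1) W_r W_incr[OF cd] by simp
qed

text \<open>Sturm comparison for equations on \<open>(0, R)\<close> that may be singular at 0: the singular point counts
  as a zero of \<open>w\<close> if the Wronskian vanishes there.\<close>

lemma sturm_zero_between:
  fixes v w v' w' G K :: "real \<Rightarrow> real"
  assumes "0 \<le> l" "l < r" "r < R"
    and v: "\<And>t. 0 < t \<Longrightarrow> t < R \<Longrightarrow> (v has_real_derivative v' t) (at t)"
      "\<And>t. 0 < t \<Longrightarrow> t < R \<Longrightarrow> (v' has_real_derivative - G t * v t) (at t)"
    and w: "\<And>t. 0 < t \<Longrightarrow> t < R \<Longrightarrow> (w has_real_derivative w' t) (at t)"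
      "\<And>t. 0 < t \<Longrightarrow> t < R \<Longrightarrow> (w' has_real_derivative - K t * w t) (at t)"
    and less: "\<And>t. 0 < t \<Longrightarrow> t < R \<Longrightarrow> K t < G t"
    and W0: "((\<lambda>t. v t * w' t - v' t * w t) \<longlongrightarrow> 0) (at_right 0)"
    and l: "l = 0 \<or> w l = 0" and r: "w r = 0"
    and nz: "\<And>t. l < t \<Longrightarrow> t < r \<Longrightarrow> w t \<noteq> 0"
  shows "\<exists>t. l < t \<and> t < r \<and> v t = 0"
proof (rule ccontr)
  assume no: "\<not> ?thesis"
  have cont: "continuous_on {l<..<r} f"
    if "\<And>t. 0 < t \<Longrightarrow> t < R \<Longrightarrow> (f has_real_derivative f' t) (at t)" for f f' :: "real \<Rightarrow> real"
    by (intro continuous_at_imp_continuous_on ballI DERIV_isCont[OF that]) (use assms(1-3) in auto)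
  obtain a where a: "\<And>t. l < t \<Longrightarrow> t < r \<Longrightarrow> 0 < a * v t"
    using nonvanishing_constant_sign[OF cont[OF v(1)]] no by metis
  obtain b where b: "\<And>t. l < t \<Longrightarrow> t < r \<Longrightarrow> 0 < b * w t"
    using nonvanishing_constant_sign[OF cont[OF w(1)]] nz by metis
  show False
  proof (rule sturm_positive[OF assms(1-3),
        of "\<lambda>t. a * v t" "\<lambda>t. a * v' t" G "\<lambda>t. b * w t" "\<lambda>t. b * w' t" K])
    show "((\<lambda>t. a * v' t) has_real_derivative - G t * (a * v t)) (at t)" if "0 < t" "t < R" for t
      using DERIV_cmult[OF v(2)[OF that], of a] by (simp add: mult_ac)
    show "((\<lambda>t. b * w' t) has_real_derivative - K t * (b * w t)) (at t)" if "0 < t" "t < R" for t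
      using DERIV_cmult[OF w(2)[OF that], of b] by (simp add: mult_ac)
    show "((\<lambda>t. a * v t * (b * w' t) - a * v' t * (b * w t)) \<longlongrightarrow> 0) (at_right 0)"
      using tendsto_mult_left[OF W0, of "a * b"] by (simp add: algebra_simps)
  qed (use DERIV_cmult[OF v(1)] DERIV_cmult[OF w(1)] less l r a b in auto)
qed

text \<open>The Wronskian is now constant, hence 0, so at a zero of \<open>v\<close> either \<open>w\<close> or \<open>v'\<close> vanishes. A common
  zero of \<open>v\<close> and \<open>v'\<close> would make the conserved energy \<open>v'\<^sup>2 + c * v\<^sup>2\<close> vanish everywhere, also at \<open>b\<close>.\<close>

lemma equal_coefficient_same_zeros:
  fixes v w v' w' :: "real \<Rightarrow> real"
  assumes v: "\<And>t. 0 < t \<Longrightarrow> t < R \<Longrightarrow> (v has_real_derivative v' t) (at t)"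
      "\<And>t. 0 < t \<Longrightarrow> t < R \<Longrightarrow> (v' has_real_derivative - c * v t) (at t)"
    and w: "\<And>t. 0 < t \<Longrightarrow> t < R \<Longrightarrow> (w has_real_derivative w' t) (at t)"
      "\<And>t. 0 < t \<Longrightarrow> t < R \<Longrightarrow> (w' has_real_derivative - c * w t) (at t)"
    and c: "0 < c"
    and W0: "((\<lambda>t. v t * w' t - v' t * w t) \<longlongrightarrow> 0) (at_right 0)"
    and nz: "0 < b" "b < R" "v b \<noteq> 0"
    and a: "0 < a" "a < R" "v a = 0"
  shows "w a = 0"
proof -
  have const: "f x = f y"
    if "\<And>t. 0 < t \<Longrightarrow> t < R \<Longrightarrow> (f has_real_derivative 0) (at t)" "0 < x" "x < R" "0 < y" "y < R"
    for f :: "real \<Rightarrow> real" and x y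
  proof -
    have "\<exists>k. \<forall>t\<in>{0<..<R}. f t = k"
      using that(1) by (intro has_field_derivative_zero_constant) (auto intro: has_field_derivative_at_within)
    then show ?thesis using that(2-) by auto
  qed
  define W where "W = (\<lambda>t. v t * w' t - v' t * w t)"
  have dW: "(W has_real_derivative 0) (at t)" if "0 < t" "t < R" for t
    unfolding W_def
    by (rule DERIV_cong[OF DERIV_diff[OF DERIV_mult[OF v(1) w(2)] DERIV_mult[OF v(2) w(1)]]])
      (use that in \<open>auto simp: algebra_simps\<close>)
  have "(W \<longlongrightarrow> W a) (at_right 0)"
  proof (rule tendsto_eventually)
    show "eventually (\<lambda>t. W t = W a) (at_right 0)"
      using eventually_at_right_real[OF a(1)]
      by (rule eventually_mono) (use a(1,2) in \<open>auto intro!: const[of W _ a] dW\<close>)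
  qed
  then have "W a = 0"
    using W0 unfolding W_def[symmetric] by (intro tendsto_unique[of "at_right (0::real)" W]) auto
  then have *: "v' a = 0 \<or> w a = 0" unfolding W_def a(3) by simp
  define E where "E = (\<lambda>t. v' t * v' t + c * (v t * v t))"
  have dE: "(E has_real_derivative 0) (at t)" if "0 < t" "t < R" for t
    unfolding E_def
    by (rule DERIV_cong[OF DERIV_add[OF DERIV_mult[OF v(2) v(2)] DERIV_cmult[OF DERIV_mult[OF v(1) v(1)]]]])
      (use that in \<open>auto simp: algebra_simps\<close>)
  have "E a = E b" by (intro const[of E] dE a nz)
  moreover have "0 < v b * v b" using nz(3) by (auto simp: zero_less_mult_iff linorder_neq_iff)
  then have "0 < E b" unfolding E_def using c by (simp add: add_nonneg_pos)
  ultimately have "v' a \<noteq> 0" unfolding E_def a(3) by auto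
  with * show ?thesis by simp
qed

section \<open>The Liouville form of the Jacobi equation\<close>

definition jacobi_u :: "real \<Rightarrow> real \<Rightarrow> nat \<Rightarrow> real \<Rightarrow> real" where
  "jacobi_u \<alpha> \<beta> n x = sin x powr (\<alpha> + 1/2) * cos x powr (\<beta> + 1/2) * poly (jacobi_y \<alpha> \<beta> n) ((sin x)\<^sup>2)"

text \<open>The logarithmic derivative of \<open>sin x powr (\<alpha> + 1/2) * cos x powr (\<beta> + 1/2)\<close>.\<close>

definition jacobi_log_deriv :: "real \<Rightarrow> real \<Rightarrow> real \<Rightarrow> real" where
  "jacobi_log_deriv \<alpha> \<beta> x = (\<alpha> + 1/2) * (cos x / sin x) - (\<beta> + 1/2) * (sin x / cos x)"

definition jacobi_u' :: "real \<Rightarrow> real \<Rightarrow> nat \<Rightarrow> real \<Rightarrow> real" where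
  "jacobi_u' \<alpha> \<beta> n x = sin x powr (\<alpha> + 1/2) * cos x powr (\<beta> + 1/2) *
     (poly (pderiv (jacobi_y \<alpha> \<beta> n)) ((sin x)\<^sup>2) * (2 * sin x * cos x) +
      jacobi_log_deriv \<alpha> \<beta> x * poly (jacobi_y \<alpha> \<beta> n) ((sin x)\<^sup>2))"

text \<open>Write \<open>u = h * q\<close> with \<open>h' = H * h\<close>. Then \<open>u'' = h * (q'' + 2 * H * q' + (H' + H\<^sup>2) * q)\<close>. The exponents in
  \<open>h\<close> are chosen such that \<open>q'' + 2 * H * q'\<close> is four times the differential operator in the
  equation of \<open>jacobi_y\<close>, at \<open>y = (sin x)\<^sup>2\<close>.\<close>

lemma jacobi_u_derivs:
  assumes "\<alpha> > -1" "\<beta> > -1" "0 < x" "x < pi / 2"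
  shows "(jacobi_u \<alpha> \<beta> n has_real_derivative jacobi_u' \<alpha> \<beta> n x) (at x)"
    and "(jacobi_u' \<alpha> \<beta> n has_real_derivative
      - (4 * ((real n + rho \<alpha> \<beta>)\<^sup>2 + (1 - 4 * \<alpha>\<^sup>2) / 16 / (sin x)\<^sup>2 + (1 - 4 * \<beta>\<^sup>2) / 16 / (cos x)\<^sup>2))
      * jacobi_u \<alpha> \<beta> n x) (at x)"
proof -
  let ?Q = "jacobi_y \<alpha> \<beta> n"
  define S C where "S = sin x" and "C = cos x"
  have SC: "0 < S" "0 < C" using assms sin_gt_zero2 cos_gt_zero unfolding S_def C_def by auto
  have CS: "C\<^sup>2 = 1 - S\<^sup>2" unfolding S_def C_def by (rule cos_squared_eq)
  define h where "h = (\<lambda>x. sin x powr (\<alpha> + 1/2) * cos x powr (\<beta> + 1/2))"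
  have "((\<lambda>x. sin x powr (\<alpha> + 1/2)) has_real_derivative
        (\<alpha> + 1/2) * S powr (\<alpha> + 1/2 - of_nat 1) * C) (at x)"
    "((\<lambda>x. cos x powr (\<beta> + 1/2)) has_real_derivative
        (\<beta> + 1/2) * C powr (\<beta> + 1/2 - of_nat 1) * (- S)) (at x)"
    using SC unfolding S_def C_def by (intro DERIV_fun_powr; auto intro!: derivative_eq_intros)+
  note dp = DERIV_mult[OF this]
  have pw: "S powr (\<alpha> + 1/2 - of_nat 1) = S powr (\<alpha> + 1/2) / S"
    "C powr (\<beta> + 1/2 - of_nat 1) = C powr (\<beta> + 1/2) / C"
    unfolding of_nat_1 powr_diff using SC by simp_all
  have dh: "(h has_real_derivative h x * jacobi_log_deriv \<alpha> \<beta> x) (at x)"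
    unfolding h_def
    by (rule DERIV_cong[OF dp])
      (simp only: pw jacobi_log_deriv_def S_def[symmetric] C_def[symmetric],
        use SC in \<open>simp add: field_simps\<close>)
  have dy: "((\<lambda>x. poly p ((sin x)\<^sup>2)) has_real_derivative poly (pderiv p) (S\<^sup>2) * (2 * S * C)) (at x)" for p
    unfolding S_def C_def
    by (rule DERIV_chain2[OF poly_DERIV]) (auto intro!: derivative_eq_intros)
  have u_eq: "jacobi_u \<alpha> \<beta> n = (\<lambda>x. h x * poly ?Q ((sin x)\<^sup>2))"
    by (simp add: fun_eq_iff jacobi_u_def h_def)
  show "(jacobi_u \<alpha> \<beta> n has_real_derivative jacobi_u' \<alpha> \<beta> n x) (at x)"
    unfolding u_eq
    by (rule DERIV_cong[OF DERIV_mult[OF dh dy]])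
      (simp add: jacobi_u'_def h_def S_def C_def algebra_simps)
  have dH: "(jacobi_log_deriv \<alpha> \<beta> has_real_derivative
      - (\<alpha> + 1/2) / S\<^sup>2 - (\<beta> + 1/2) / C\<^sup>2) (at x)"
  proof -
    have nz: "sin x \<noteq> 0" "cos x \<noteq> 0" using SC unfolding S_def C_def by auto
    have num: "- S * S - C * C = -1" "C * C - S * - S = 1"
      using CS by (simp_all add: power2_eq_square)
    have "((\<lambda>x. cos x / sin x) has_real_derivative - 1 / (S * S)) (at x)"
      by (rule DERIV_cong[OF DERIV_divide[OF DERIV_cos DERIV_sin nz(1)]])
        (simp only: S_def[symmetric] C_def[symmetric] num)
    moreover have "((\<lambda>x. sin x / cos x) has_real_derivative 1 / (C * C)) (at x)"
      by (rule DERIV_cong[OF DERIV_divide[OF DERIV_sin DERIV_cos nz(2)]])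
        (simp only: S_def[symmetric] C_def[symmetric] num)
    ultimately have "((\<lambda>x. (\<alpha> + 1/2) * (cos x / sin x) - (\<beta> + 1/2) * (sin x / cos x)) has_real_derivative
        (\<alpha> + 1/2) * (- 1 / (S * S)) - (\<beta> + 1/2) * (1 / (C * C))) (at x)"
      by (intro DERIV_diff DERIV_cmult)
    then show ?thesis
      unfolding jacobi_log_deriv_def[abs_def] power2_eq_square
      by (rule DERIV_cong) (simp add: add_divide_distrib diff_divide_distrib)
  qed
  have dsc: "((\<lambda>x. 2 * sin x * cos x) has_real_derivative 2 * (1 - 2 * S\<^sup>2)) (at x)"
  proof -
    have "((\<lambda>x. 2 * sin x * cos x) has_real_derivative 2 * C\<^sup>2 - 2 * S\<^sup>2) (at x)"
      unfolding S_def C_def by (auto intro!: derivative_eq_intros simp: power2_eq_square)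
    then show ?thesis by (simp add: CS)
  qed
  define q q1 q2 H where "q = poly ?Q (S\<^sup>2)" and "q1 = poly (pderiv ?Q) (S\<^sup>2)"
    and "q2 = poly (pderiv (pderiv ?Q)) (S\<^sup>2)" and "H = jacobi_log_deriv \<alpha> \<beta> x"
  have ode: "S\<^sup>2 * C\<^sup>2 * q2 + (\<alpha> + 1 - (\<alpha> + \<beta> + 2) * S\<^sup>2) * q1 = - jacobi_ev \<alpha> \<beta> n * q"
    using arg_cong[OF jacobi_y_ode[OF assms(1,2), of n], of "\<lambda>p. poly p (S\<^sup>2)"]
    unfolding CS q_def q1_def q2_def by (simp add: algebra_simps)
  have HSC: "H * (2 * S * C) = (2 * \<alpha> + 1) * C\<^sup>2 - (2 * \<beta> + 1) * S\<^sup>2"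
    unfolding H_def jacobi_log_deriv_def S_def[symmetric] C_def[symmetric]
    using SC by (simp add: field_simps power2_eq_square)
  have H2: "H\<^sup>2 = (\<alpha> + 1/2)\<^sup>2 * (1 / S\<^sup>2 - 1) - 2 * (\<alpha> + 1/2) * (\<beta> + 1/2) + (\<beta> + 1/2)\<^sup>2 * (1 / C\<^sup>2 - 1)"
  proof -
    have "H\<^sup>2 = (\<alpha> + 1/2)\<^sup>2 * (C / S)\<^sup>2 - 2 * (\<alpha> + 1/2) * (\<beta> + 1/2) + (\<beta> + 1/2)\<^sup>2 * (S / C)\<^sup>2"
      unfolding H_def jacobi_log_deriv_def S_def[symmetric] C_def[symmetric] power2_diff power_mult_distrib
      using SC by simp
    moreover have "(C / S)\<^sup>2 = 1 / S\<^sup>2 - 1" using SC by (simp add: power_divide CS field_simps)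
    moreover have "(S / C)\<^sup>2 = 1 / C\<^sup>2 - 1"
    proof -
      have "S\<^sup>2 = 1 - C\<^sup>2" using CS by simp
      then show ?thesis using SC by (simp add: power_divide field_simps)
    qed
    ultimately show ?thesis by simp
  qed
  have alg: "H * (q1 * (2 * S * C) + H * q) +
      (q2 * (2 * S * C) * (2 * S * C) + 2 * (1 - 2 * S\<^sup>2) * q1 +
       ((- (\<alpha> + 1/2) / S\<^sup>2 - (\<beta> + 1/2) / C\<^sup>2) * q + q1 * (2 * S * C) * H)) =
      - (4 * ((real n + rho \<alpha> \<beta>)\<^sup>2 + (1 - 4 * \<alpha>\<^sup>2) / 16 / S\<^sup>2 + (1 - 4 * \<beta>\<^sup>2) / 16 / C\<^sup>2)) * q"
    (is "?lhs = ?rhs")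
  proof -
    define i j where "i = 1 / S\<^sup>2" and "j = 1 / C\<^sup>2"
    have ij: "a / S\<^sup>2 = a * i" "a / C\<^sup>2 = a * j" for a unfolding i_def j_def by simp_all
    have "?lhs = 2 * (H * (2 * S * C)) * q1 + 4 * (S\<^sup>2 * C\<^sup>2 * q2) + 2 * (1 - 2 * S\<^sup>2) * q1 + (H\<^sup>2
        - (\<alpha> + 1/2) / S\<^sup>2 - (\<beta> + 1/2) / C\<^sup>2) * q"
      unfolding ij by (simp add: algebra_simps power2_eq_square)
    also have "\<dots> = 4 * (S\<^sup>2 * C\<^sup>2 * q2 + (\<alpha> + 1 - (\<alpha> + \<beta> + 2) * S\<^sup>2) * q1) + (H\<^sup>2
        - (\<alpha> + 1/2) / S\<^sup>2 - (\<beta> + 1/2) / C\<^sup>2) * q"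
      unfolding HSC CS ij by (simp add: algebra_simps)
    also have "\<dots> = ?rhs"
      unfolding ode H2 jacobi_ev_def rho_def ij by (simp add: field_simps power2_eq_square)
    finally show ?thesis .
  qed
  have "((\<lambda>x. h x * (poly (pderiv ?Q) ((sin x)\<^sup>2) * (2 * sin x * cos x) +
      jacobi_log_deriv \<alpha> \<beta> x * poly ?Q ((sin x)\<^sup>2))) has_real_derivative
     h x * (H * (q1 * (2 * S * C) + H * q) +
      (q2 * (2 * S * C) * (2 * S * C) + 2 * (1 - 2 * S\<^sup>2) * q1 +
       ((- (\<alpha> + 1/2) / S\<^sup>2 - (\<beta> + 1/2) / C\<^sup>2) * q + q1 * (2 * S * C) * H)))) (at x)"
    by (rule DERIV_cong[OF DERIV_mult[OF dh DERIV_add[OF DERIV_mult[OF dy dsc] DERIV_mult[OF dH dy]]]])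
      (simp add: q_def q1_def q2_def H_def S_def C_def algebra_simps)
  then show "(jacobi_u' \<alpha> \<beta> n has_real_derivative
      - (4 * ((real n + rho \<alpha> \<beta>)\<^sup>2 + (1 - 4 * \<alpha>\<^sup>2) / 16 / (sin x)\<^sup>2 + (1 - 4 * \<beta>\<^sup>2) / 16 / (cos x)\<^sup>2))
      * jacobi_u \<alpha> \<beta> n x) (at x)"
    unfolding alg
    by (simp add: jacobi_u'_def[abs_def] jacobi_u_def h_def q_def S_def C_def mult_ac)
qed

lemma jacobi_u_eq_0_iff:
  assumes "0 < x" "x < pi / 2"
  shows "jacobi_u \<alpha> \<beta> n x = 0 \<longleftrightarrow> poly (jacobi_y \<alpha> \<beta> n) ((sin x)\<^sup>2) = 0"
  using assms sin_gt_zero2[of x] cos_gt_zero[of x] unfolding jacobi_u_def by simp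

definition scaled_u :: "real \<Rightarrow> real \<Rightarrow> nat \<Rightarrow> real \<Rightarrow> real \<Rightarrow> real" where
  "scaled_u \<alpha> \<beta> n s t = jacobi_u \<alpha> \<beta> n (t / s)"

definition scaled_u' :: "real \<Rightarrow> real \<Rightarrow> nat \<Rightarrow> real \<Rightarrow> real \<Rightarrow> real" where
  "scaled_u' \<alpha> \<beta> n s t = jacobi_u' \<alpha> \<beta> n (t / s) / s"

lemma scaled_u_derivs:
  assumes "\<alpha> > -1" "\<beta> > -1" "0 < s" "0 < t" "t < s * (pi / 2)"
    and \<delta>: "s + \<delta> = real n + rho \<alpha> \<beta>"
  shows "(scaled_u \<alpha> \<beta> n s has_real_derivative scaled_u' \<alpha> \<beta> n s t) (at t)"
    and "(scaled_u' \<alpha> \<beta> n s has_real_derivative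
      - scaled_coeff \<alpha> \<beta> \<delta> s t * scaled_u \<alpha> \<beta> n s t) (at t)"
proof -
  have x: "0 < t / s" "t / s < pi / 2" using assms by (auto simp: field_simps)
  have d: "((\<lambda>t. t / s) has_real_derivative 1 / s) (at t)"
    by (rule DERIV_cdivide[OF DERIV_ident])
  define K where "K = (real n + rho \<alpha> \<beta>)\<^sup>2 + (1 - 4 * \<alpha>\<^sup>2) / 16 / (sin (t / s))\<^sup>2 +
      (1 - 4 * \<beta>\<^sup>2) / 16 / (cos (t / s))\<^sup>2"
  note u = jacobi_u_derivs[OF assms(1,2) x, of n, folded K_def]
  have K: "scaled_coeff \<alpha> \<beta> \<delta> s t = 4 * K / (s * s)"
    unfolding scaled_coeff_def \<delta> K_def power2_eq_square[of s] ..
  show "(scaled_u \<alpha> \<beta> n s has_real_derivative scaled_u' \<alpha> \<beta> n s t) (at t)"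
    using DERIV_chain2[OF u(1) d] unfolding scaled_u_def[abs_def] scaled_u'_def by simp
  show "(scaled_u' \<alpha> \<beta> n s has_real_derivative
      - scaled_coeff \<alpha> \<beta> \<delta> s t * scaled_u \<alpha> \<beta> n s t) (at t)"
    unfolding scaled_u_def scaled_u'_def[abs_def]
    by (rule DERIV_cong[OF DERIV_cdivide[OF DERIV_chain2[OF u(2) d]]])
      (simp add: K)
qed

section \<open>The Wronskian at the singular end\<close>

text \<open>The product is of order \<open>t powr (2 * \<alpha> + 2)\<close>, and \<open>\<alpha> > -1\<close>.\<close>

lemma sin_powr_product_limit:
  fixes \<alpha> c d :: real
  assumes "\<alpha> > -1" "0 < c" "0 < d"
  shows "((\<lambda>t. sin (t / c) powr (\<alpha> + 1/2) * sin (t / d) powr (\<alpha> + 1/2) * t) \<longlongrightarrow> 0) (at_right 0)"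
proof -
  have lim: "((\<lambda>t. sin (t / c) / t) \<longlongrightarrow> 1 / c) (at_right 0)" if "0 < c" for c :: real
    using that by (real_asymp simp: field_simps)
  have "((\<lambda>t. (sin (t / c) / t) powr (\<alpha> + 1/2) * (sin (t / d) / t) powr (\<alpha> + 1/2) * t powr (2 * \<alpha> + 2))
      \<longlongrightarrow> (1 / c) powr (\<alpha> + 1/2) * (1 / d) powr (\<alpha> + 1/2) * 0) (at_right 0)"
  proof (intro tendsto_mult tendsto_powr lim tendsto_const)
    have "((\<lambda>t::real. t powr (2 * \<alpha> + 2)) \<longlongrightarrow> 0 powr (2 * \<alpha> + 2)) (at_right 0)"
      using assms(1) by (intro tendsto_powr' tendsto_intros) (auto simp: eventually_at_filter)
    then show "((\<lambda>t::real. t powr (2 * \<alpha> + 2)) \<longlongrightarrow> 0) (at_right 0)" by simp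
  qed (use assms in auto)
  then have lim0: "((\<lambda>t. (sin (t / c) / t) powr (\<alpha> + 1/2) * (sin (t / d) / t) powr (\<alpha> + 1/2) *
      t powr (2 * \<alpha> + 2)) \<longlongrightarrow> 0) (at_right 0)" by simp
  show ?thesis
  proof (rule Lim_transform_eventually[OF lim0])
    have "0 < min (c * pi) (d * pi)" using assms by simp
    from eventually_at_right_real[OF this]
    show "eventually (\<lambda>t. (sin (t / c) / t) powr (\<alpha> + 1/2) * (sin (t / d) / t) powr (\<alpha> + 1/2) *
      t powr (2 * \<alpha> + 2) = sin (t / c) powr (\<alpha> + 1/2) * sin (t / d) powr (\<alpha> + 1/2) * t) (at_right 0)"
    proof (rule eventually_mono)
      fix t assume "t \<in> {0<..<min (c * pi) (d * pi)}"
      then have t: "0 < t" "t / c < pi" "t / d < pi" using assms by (auto simp: field_simps)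
      then have "0 < sin (t / c)" "0 < sin (t / d)" using assms by (auto intro!: sin_gt_zero)
      moreover have "t powr (2 * \<alpha> + 2) = t powr (\<alpha> + 1/2) * t powr (\<alpha> + 1/2) * t"
      proof -
        have "t powr (2 * \<alpha> + 2) = t powr ((\<alpha> + 1/2) + (\<alpha> + 1/2) + 1)"
          by (simp add: algebra_simps)
        then show ?thesis using t(1) by (simp only: powr_add powr_one)
      qed
      ultimately show "(sin (t / c) / t) powr (\<alpha> + 1/2) * (sin (t / d) / t) powr (\<alpha> + 1/2) *
        t powr (2 * \<alpha> + 2) = sin (t / c) powr (\<alpha> + 1/2) * sin (t / d) powr (\<alpha> + 1/2) * t"
        using t(1) by (simp add: powr_divide)
    qed
  qed
qed

text \<open>The common factor of the Wronskian is, up to powers of cosines, the product of powers of sines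
  treated above without its factor \<open>t\<close>. It remains to see that the rest, divided by \<open>t\<close>, has a finite
  limit.\<close>

lemma wronskian_limit:
  assumes "\<alpha> > -1" "0 < c" "0 < d"
  shows "((\<lambda>t. scaled_u \<alpha> \<beta> m c t * scaled_u' \<alpha> \<beta> n d t - scaled_u' \<alpha> \<beta> m c t * scaled_u \<alpha> \<beta> n d t)
    \<longlongrightarrow> 0) (at_right 0)"
proof -
  let ?P = "jacobi_y \<alpha> \<beta> m" and ?Q = "jacobi_y \<alpha> \<beta> n"
  have poly_lim: "((\<lambda>t. poly p ((sin (t / c))\<^sup>2)) \<longlongrightarrow> poly p 0) (at_right 0)" if "0 < c" for c :: real and p :: "real poly"
  proof -
    have "((\<lambda>t. poly p ((sin (t / c))\<^sup>2)) \<longlongrightarrow> poly p ((sin (0 / c))\<^sup>2)) (at_right 0)"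
      using that by (intro tendsto_intros) auto
    then show ?thesis by simp
  qed
  have cos_lim: "((\<lambda>t. cos (t / c) powr (\<beta> + 1/2)) \<longlongrightarrow> 1) (at_right 0)" if "0 < c" for c :: real
  proof -
    have "((\<lambda>t. cos (t / c) powr (\<beta> + 1/2)) \<longlongrightarrow> cos (0 / c) powr (\<beta> + 1/2)) (at_right 0)"
      using that by (intro tendsto_intros) auto
    then show ?thesis by simp
  qed
  have sc_lim: "((\<lambda>t. 2 * sin (t / c) * cos (t / c) / t) \<longlongrightarrow> 2 / c) (at_right 0)" if "0 < c" for c :: real
    using that by (real_asymp simp: field_simps)
  have cot_lim: "((\<lambda>t. (cos (t / c) / sin (t / c) / c - 1 / t) / t) \<longlongrightarrow> - (1 / (3 * c\<^sup>2))) (at_right 0)"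
    if "0 < c" for c :: real
    using that by (real_asymp simp: field_simps power2_eq_square)
  have tan_lim: "((\<lambda>t. (sin (t / c) / cos (t / c) / c) / t) \<longlongrightarrow> 1 / c\<^sup>2) (at_right 0)"
    if "0 < c" for c :: real
    using that by (real_asymp simp: field_simps power2_eq_square)
  \<comment> \<open>\<open>t * E c t\<close> is the logarithmic derivative of the prefactor after stretching by \<open>c\<close>, minus its
    singular part \<open>(\<alpha> + 1/2) / t\<close>, which is the same for every \<open>c\<close>.\<close>
  define E where "E = (\<lambda>c t. (\<alpha> + 1/2) * ((cos (t / c) / sin (t / c) / c - 1 / t) / t)
      - (\<beta> + 1/2) * ((sin (t / c) / cos (t / c) / c) / t))"
  have E_lim: "\<exists>L. ((\<lambda>t. E c t) \<longlongrightarrow> L) (at_right 0)" if "0 < c" for c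
    using tendsto_diff[OF tendsto_mult_left[OF cot_lim[OF that], of "\<alpha> + 1/2"]
        tendsto_mult_left[OF tan_lim[OF that], of "\<beta> + 1/2"]]
    unfolding E_def by blast
  \<comment> \<open>The Wronskian without its prefactors, divided by \<open>t\<close>.\<close>
  define B where "B = (\<lambda>t. poly ?P ((sin (t / c))\<^sup>2) * poly (pderiv ?Q) ((sin (t / d))\<^sup>2) *
        ((2 * sin (t / d) * cos (t / d)) / t) / d
      - poly (pderiv ?P) ((sin (t / c))\<^sup>2) * poly ?Q ((sin (t / d))\<^sup>2) *
        ((2 * sin (t / c) * cos (t / c)) / t) / c
      + (E d t - E c t) * poly ?P ((sin (t / c))\<^sup>2) * poly ?Q ((sin (t / d))\<^sup>2))"
  obtain Lc Ld where L: "(E c \<longlongrightarrow> Lc) (at_right 0)" "(E d \<longlongrightarrow> Ld) (at_right 0)"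
    using E_lim assms(2,3) by blast
  obtain M where M: "(B \<longlongrightarrow> M) (at_right 0)"
  proof
    show "(B \<longlongrightarrow> poly ?P 0 * poly (pderiv ?Q) 0 * (2 / d) / d
      - poly (pderiv ?P) 0 * poly ?Q 0 * (2 / c) / c
      + (Ld - Lc) * poly ?P 0 * poly ?Q 0) (at_right 0)"
      unfolding B_def using assms
      by (intro tendsto_add tendsto_diff tendsto_mult tendsto_divide poly_lim sc_lim L tendsto_const) auto
  qed
  have "((\<lambda>t. sin (t / c) powr (\<alpha> + 1/2) * sin (t / d) powr (\<alpha> + 1/2) * t *
      (cos (t / c) powr (\<beta> + 1/2) * cos (t / d) powr (\<beta> + 1/2)) * B t)
      \<longlongrightarrow> 0 * (1 * 1) * M) (at_right 0)"
    by (intro tendsto_mult sin_powr_product_limit cos_lim M assms)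
  then have lim0: "((\<lambda>t. sin (t / c) powr (\<alpha> + 1/2) * sin (t / d) powr (\<alpha> + 1/2) * t *
      (cos (t / c) powr (\<beta> + 1/2) * cos (t / d) powr (\<beta> + 1/2)) * B t) \<longlongrightarrow> 0) (at_right 0)"
    by simp
  show ?thesis
  proof (rule Lim_transform_eventually[OF lim0])
    show "eventually (\<lambda>t. sin (t / c) powr (\<alpha> + 1/2) * sin (t / d) powr (\<alpha> + 1/2) * t *
      (cos (t / c) powr (\<beta> + 1/2) * cos (t / d) powr (\<beta> + 1/2)) * B t =
      scaled_u \<alpha> \<beta> m c t * scaled_u' \<alpha> \<beta> n d t - scaled_u' \<alpha> \<beta> m c t * scaled_u \<alpha> \<beta> n d t) (at_right 0)"
      using eventually_at_right_less[of "0::real"]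
    proof (rule eventually_mono)
      fix t :: real assume t: "0 < t"
      define Y Y' Z Z' where "Y = poly ?P ((sin (t / c))\<^sup>2)" and "Y' = poly (pderiv ?P) ((sin (t / c))\<^sup>2)"
        and "Z = poly ?Q ((sin (t / d))\<^sup>2)" and "Z' = poly (pderiv ?Q) ((sin (t / d))\<^sup>2)"
      define k where "k = (\<lambda>c. 2 * sin (t / c) * cos (t / c))"
      have E: "t * E c t = jacobi_log_deriv \<alpha> \<beta> (t / c) / c - (\<alpha> + 1/2) / t" for c
        using t unfolding E_def jacobi_log_deriv_def
        by (simp add: right_diff_distrib diff_divide_distrib)
      have "t * B t = Y * Z' * k d / d - Y' * Z * k c / c + (t * E d t - t * E c t) * Y * Z"
        using t unfolding B_def Y_def[symmetric] Y'_def[symmetric] Z_def[symmetric] Z'_def[symmetric]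
          k_def by (simp add: field_simps)
      then have tB: "t * B t = Y * Z' * k d / d - Y' * Z * k c / c +
          (jacobi_log_deriv \<alpha> \<beta> (t / d) / d - jacobi_log_deriv \<alpha> \<beta> (t / c) / c) * Y * Z"
        unfolding E by (simp add: algebra_simps)
      have "sin (t / c) powr (\<alpha> + 1/2) * sin (t / d) powr (\<alpha> + 1/2) * t *
          (cos (t / c) powr (\<beta> + 1/2) * cos (t / d) powr (\<beta> + 1/2)) * B t =
        sin (t / c) powr (\<alpha> + 1/2) * sin (t / d) powr (\<alpha> + 1/2) *
          (cos (t / c) powr (\<beta> + 1/2) * cos (t / d) powr (\<beta> + 1/2)) * (t * B t)"
        by (simp only: mult_ac)
      also have "\<dots> = scaled_u \<alpha> \<beta> m c t * scaled_u' \<alpha> \<beta> n d t - scaled_u' \<alpha> \<beta> m c t * scaled_u \<alpha> \<beta> n d t"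
        unfolding tB scaled_u_def scaled_u'_def jacobi_u_def jacobi_u'_def Y_def[symmetric] Y'_def[symmetric]
          Z_def[symmetric] Z'_def[symmetric] k_def
        by (simp add: algebra_simps add_divide_distrib diff_divide_distrib)
      finally show "sin (t / c) powr (\<alpha> + 1/2) * sin (t / d) powr (\<alpha> + 1/2) * t *
          (cos (t / c) powr (\<beta> + 1/2) * cos (t / d) powr (\<beta> + 1/2)) * B t =
        scaled_u \<alpha> \<beta> m c t * scaled_u' \<alpha> \<beta> n d t - scaled_u' \<alpha> \<beta> m c t * scaled_u \<alpha> \<beta> n d t" .
    qed
  qed
qed

section \<open>Comparison of the zeros\<close>

text \<open>The cosines of the \<open>j\<close> given angles are distinct roots of a polynomial of degree \<open>j\<close>, so there is
  no room for a further root.\<close>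

lemma jacobi_zeros_exhausted:
  fixes \<phi> :: "nat \<Rightarrow> real"
  assumes "\<alpha> > -1" "\<beta> > -1"
    and zero: "\<And>k. 1 \<le> k \<Longrightarrow> k \<le> j \<Longrightarrow>
      0 < \<phi> k \<and> \<phi> k < pi \<and> poly (jacobi_poly \<alpha> \<beta> j) (cos (\<phi> k)) = 0"
    and mono: "\<And>k l. 1 \<le> k \<Longrightarrow> k < l \<Longrightarrow> l \<le> j \<Longrightarrow> \<phi> k < \<phi> l"
    and t: "0 < t" "t < pi" "poly (jacobi_poly \<alpha> \<beta> j) (cos t) = 0"
  shows "\<exists>k. 1 \<le> k \<and> k \<le> j \<and> t = \<phi> k"
proof -
  let ?p = "jacobi_poly \<alpha> \<beta> j"
  have deg: "degree ?p = j"
    by (simp add: jacobi_poly_eq_explicit degree_jacobi_explicit assms(1,2))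
  have "poly ?p 1 \<noteq> 0"
    using pochhammer_pos[of "\<alpha> + 1" j] assms(1)
    by (simp add: jacobi_poly_eq_explicit jacobi_explicit_at_1 assms(1,2))
  then have p: "?p \<noteq> 0" by auto
  have inj: "inj_on (\<lambda>k. cos (\<phi> k)) {1..j}"
  proof (rule inj_onI)
    fix k l assume kl: "k \<in> {1..j}" "l \<in> {1..j}" "cos (\<phi> k) = cos (\<phi> l)"
    then have "\<phi> k = \<phi> l"
      using zero[of k] zero[of l] by (intro cos_inj_pi[of "\<phi> k"]) auto
    then show "k = l" using mono[of k l] mono[of l k] kl by (cases k l rule: linorder_cases) auto
  qed
  have "(\<lambda>k. cos (\<phi> k)) ` {1..j} = {x. poly ?p x = 0}"
  proof (rule card_subset_eq)
    show "finite {x. poly ?p x = 0}" using p by (rule poly_roots_finite)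
    show sub: "(\<lambda>k. cos (\<phi> k)) ` {1..j} \<subseteq> {x. poly ?p x = 0}" using zero by auto
    show "card ((\<lambda>k. cos (\<phi> k)) ` {1..j}) = card {x. poly ?p x = 0}"
      using card_mono[OF poly_roots_finite[OF p] sub] card_image[OF inj]
        card_poly_roots_bound[OF p] deg by simp
  qed
  then have "cos t \<in> (\<lambda>k. cos (\<phi> k)) ` {1..j}" using t(3) by (simp only: mem_Collect_eq)
  then obtain k where k: "k \<in> {1..j}" "cos t = cos (\<phi> k)" by blast
  then have "t = \<phi> k" using zero[of k] t by (auto intro: cos_inj_pi)
  then show ?thesis using k(1) by auto
qed

lemma scaled_u_zero_iff:
  assumes "\<alpha> > -1" "\<beta> > -1" "0 < s" "0 < t" "t < s * (pi / 2)"
  shows "scaled_u \<alpha> \<beta> n s t = 0 \<longleftrightarrow> poly (jacobi_poly \<alpha> \<beta> n) (cos (2 * t / s)) = 0"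
proof -
  have "0 < t / s" "t / s < pi / 2" using assms by (auto simp: field_simps)
  then show ?thesis
    unfolding scaled_u_def by (simp add: jacobi_u_eq_0_iff jacobi_poly_cos[OF assms(1,2)])
qed

lemma scaled_u_zeros:
  fixes \<phi> :: "nat \<Rightarrow> real"
  assumes "\<alpha> > -1" "\<beta> > -1" "0 < s"
    and zero: "\<And>k. 1 \<le> k \<Longrightarrow> k \<le> j \<Longrightarrow>
      0 < \<phi> k \<and> \<phi> k < pi \<and> poly (jacobi_poly \<alpha> \<beta> j) (cos (\<phi> k)) = 0"
    and mono: "\<And>k l. 1 \<le> k \<Longrightarrow> k < l \<Longrightarrow> l \<le> j \<Longrightarrow> \<phi> k < \<phi> l"
    and t: "0 < t" "t < s * (pi / 2)"
  shows "scaled_u \<alpha> \<beta> j s t = 0 \<longleftrightarrow> (\<exists>k. 1 \<le> k \<and> k \<le> j \<and> t = s * \<phi> k / 2)"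
proof -
  have "0 < 2 * t / s" "2 * t / s < pi" using t assms(3) by (auto simp: field_simps)
  then have "\<exists>k. 1 \<le> k \<and> k \<le> j \<and> 2 * t / s = \<phi> k"
    if "poly (jacobi_poly \<alpha> \<beta> j) (cos (2 * t / s)) = 0"
    using that by (intro jacobi_zeros_exhausted[OF assms(1,2) zero mono])
  then have "poly (jacobi_poly \<alpha> \<beta> j) (cos (2 * t / s)) = 0 \<longleftrightarrow>
      (\<exists>k. 1 \<le> k \<and> k \<le> j \<and> 2 * t / s = \<phi> k)"
    using zero by metis
  moreover have "2 * t / s = \<phi> k \<longleftrightarrow> t = s * \<phi> k / 2" for k using assms(3) by (auto simp: field_simps)
  ultimately show ?thesis using scaled_u_zero_iff[OF assms(1-3) t] by simp
qed

text \<open>Let \<open>x k\<close> and \<open>y k\<close> be the zeros of the two stretched functions. By Sturm comparison the first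
  function has a zero \<open>x i\<close> strictly between \<open>y (k - 1)\<close> (or 0, if \<open>k = 1\<close>) and \<open>y k\<close>. By
  induction \<open>x (k - 1) < y (k - 1) < x i\<close>, so \<open>i \<ge> k\<close> and \<open>x k \<le> x i < y k\<close>. The first equation lives only
  on \<open>(0, R)\<close>, but if \<open>y k \<ge> R\<close>, there is nothing to compare because \<open>x k < R\<close>.\<close>

lemma scaled_angles_less:
  fixes \<alpha> \<beta> \<sigma> :: real and \<theta> :: "nat \<Rightarrow> nat \<Rightarrow> real"
  assumes "\<alpha> > -1" "\<beta> > -1" "\<bar>\<beta>\<bar> \<le> 1/2"
    and zero: "\<And>j k. 1 \<le> k \<Longrightarrow> k \<le> j \<Longrightarrow>
           0 < \<theta> j k \<and> \<theta> j k < pi \<and> poly (jacobi_poly \<alpha> \<beta> j) (cos (\<theta> j k)) = 0"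
    and mono: "\<And>j k l. 1 \<le> k \<Longrightarrow> k < l \<Longrightarrow> l \<le> j \<Longrightarrow> \<theta> j k < \<theta> j l"
    and \<sigma>: "-1 < \<sigma>" "\<sigma> \<le> sigma_up \<alpha> \<beta>"
    and ne: "\<not> (\<bar>\<alpha>\<bar> = 1/2 \<and> \<bar>\<beta>\<bar> = 1/2 \<and> \<sigma> = rho \<alpha> \<beta>)"
    and n: "1 \<le> n"
  shows "1 \<le> k \<Longrightarrow> k \<le> n \<Longrightarrow> (real n + \<sigma>) * \<theta> n k < (real n + 1 + \<sigma>) * \<theta> (n + 1) k"
proof (induction k)
  case (Suc k)
  define s \<delta> where "s = real n + \<sigma>" and "\<delta> = rho \<alpha> \<beta> - \<sigma>"
  have s: "0 < s" "1 + \<sigma> \<le> s" using n \<sigma> unfolding s_def by auto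
  define x y where "x = (\<lambda>i. s * \<theta> n i / 2)" and "y = (\<lambda>i. (s + 1) * \<theta> (n + 1) i / 2)"
  define R where "R = s * (pi / 2)"
  have R: "t < (s + 1) * (pi / 2)" if "t < R" for t
    using that unfolding R_def by (simp add: algebra_simps) (use pi_gt_zero in linarith)
  have x_le: "x i \<le> x j" if "1 \<le> i" "i \<le> j" "j \<le> n" for i j
    using mono[of i j n] that s(1) unfolding x_def by (cases "i = j") auto
  have y_le: "y i \<le> y j" if "1 \<le> i" "i \<le> j" "j \<le> n + 1" for i j
    using mono[of i j "n + 1"] that s(1) unfolding y_def by (cases "i = j") auto
  have "x (Suc k) < y (Suc k)"
  proof (cases "y (Suc k) < R")
    case False
    have "s * \<theta> n (Suc k) < s * pi" using zero[of "Suc k" n] Suc.prems s(1) by simp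
    then show ?thesis using False unfolding x_def R_def by simp
  next
    case True
    define l where "l = (if k = 0 then 0 else y k)"
    have w_zeros: "scaled_u \<alpha> \<beta> (n + 1) (s + 1) t = 0 \<longleftrightarrow> (\<exists>i. 1 \<le> i \<and> i \<le> n + 1 \<and> t = y i)"
      if "0 < t" "t < R" for t
      unfolding y_def using s(1) that R
      by (intro scaled_u_zeros assms(1,2) zero mono) auto
    have v_zeros: "scaled_u \<alpha> \<beta> n s t = 0 \<longleftrightarrow> (\<exists>i. 1 \<le> i \<and> i \<le> n \<and> t = x i)"
      if "0 < t" "t < R" for t
      unfolding x_def using s(1) that unfolding R_def
      by (intro scaled_u_zeros assms(1,2) zero mono) auto
    have y_pos: "0 < y i" if "1 \<le> i" "i \<le> n + 1" for i
      using zero[of i "n + 1"] that s(1) unfolding y_def by simp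
    have l0: "0 \<le> l" unfolding l_def using y_pos[of k] Suc.prems by auto
    have lr: "l < y (Suc k)"
      unfolding l_def using y_pos[of "Suc k"] mono[of k "Suc k" "n + 1"] Suc.prems s(1)
      by (auto simp: y_def)
    have "\<exists>t. l < t \<and> t < y (Suc k) \<and> scaled_u \<alpha> \<beta> n s t = 0"
    proof (rule sturm_zero_between[OF l0 lr True])
      fix t assume t: "0 < t" "t < R"
      show "(scaled_u \<alpha> \<beta> n s has_real_derivative scaled_u' \<alpha> \<beta> n s t) (at t)"
        "(scaled_u' \<alpha> \<beta> n s has_real_derivative - scaled_coeff \<alpha> \<beta> \<delta> s t * scaled_u \<alpha> \<beta> n s t) (at t)"
        using t s(1) by (intro scaled_u_derivs[where \<delta> = \<delta>] assms(1,2); simp add: R_def s_def \<delta>_def)+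
      show "(scaled_u \<alpha> \<beta> (n + 1) (s + 1) has_real_derivative scaled_u' \<alpha> \<beta> (n + 1) (s + 1) t) (at t)"
        "(scaled_u' \<alpha> \<beta> (n + 1) (s + 1) has_real_derivative
          - scaled_coeff \<alpha> \<beta> \<delta> (s + 1) t * scaled_u \<alpha> \<beta> (n + 1) (s + 1) t) (at t)"
        using t s(1) R[OF t(2)]
        by (intro scaled_u_derivs[where \<delta> = \<delta>] assms(1,2); simp add: s_def \<delta>_def)+
      show "scaled_coeff \<alpha> \<beta> \<delta> (s + 1) t < scaled_coeff \<alpha> \<beta> \<delta> s t"
        unfolding \<delta>_def using t s(2) ne unfolding R_def
        by (intro scaled_coeff_decreasing assms(1-3) \<sigma>) auto
    next
      show "((\<lambda>t. scaled_u \<alpha> \<beta> n s t * scaled_u' \<alpha> \<beta> (n + 1) (s + 1) t -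
          scaled_u' \<alpha> \<beta> n s t * scaled_u \<alpha> \<beta> (n + 1) (s + 1) t) \<longlongrightarrow> 0) (at_right 0)"
        using s(1) by (intro wronskian_limit assms(1)) auto
      have "scaled_u \<alpha> \<beta> (n + 1) (s + 1) l = 0" if "k \<noteq> 0"
      proof -
        have lk: "l = y k" "1 \<le> k" "k \<le> n + 1" using that Suc.prems by (auto simp: l_def)
        then have "0 < l" "l < R" using y_pos[of k] lr True by auto
        then show ?thesis using w_zeros lk by blast
      qed
      then show "l = 0 \<or> scaled_u \<alpha> \<beta> (n + 1) (s + 1) l = 0" by (auto simp: l_def)
      show "scaled_u \<alpha> \<beta> (n + 1) (s + 1) (y (Suc k)) = 0"
      proof -
        have k: "1 \<le> Suc k" "Suc k \<le> n + 1" using Suc.prems by auto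
        then show ?thesis using w_zeros[OF y_pos[OF k] True] by blast
      qed
      fix t assume t: "l < t" "t < y (Suc k)"
      show "scaled_u \<alpha> \<beta> (n + 1) (s + 1) t \<noteq> 0"
      proof
        assume "scaled_u \<alpha> \<beta> (n + 1) (s + 1) t = 0"
        then obtain i where i: "1 \<le> i" "i \<le> n + 1" "t = y i"
          using w_zeros[of t] t l0 True by auto
        have "\<not> Suc k \<le> i" using y_le[of "Suc k" i] t i by auto
        then have "y i \<le> l" using y_le[of i k] i Suc.prems by (auto simp: l_def)
        then show False using t i by simp
      qed
    qed
    then obtain t where t: "l < t" "t < y (Suc k)" "scaled_u \<alpha> \<beta> n s t = 0" by blast
    then obtain i where i: "1 \<le> i" "i \<le> n" "t = x i"
      using v_zeros[of t] l0 True by auto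
    have "\<not> i \<le> k"
    proof
      assume "i \<le> k"
      then have "x i \<le> x k" using x_le i Suc.prems by simp
      also have "x k < y k"
        using Suc.IH Suc.prems i(1) \<open>i \<le> k\<close> unfolding x_def y_def s_def by (simp add: ac_simps)
      finally show False using t(1) i \<open>i \<le> k\<close> by (auto simp: l_def)
    qed
    then have "x (Suc k) \<le> x i" using x_le[of "Suc k" i] i by simp
    then show ?thesis using t(2) i(3) by simp
  qed
  then show ?case unfolding x_def y_def s_def by (simp add: ac_simps)
qed simp

text \<open>Both stretched equations are \<open>v'' + 4 * v = 0\<close>, so on \<open>(0, R)\<close> the two functions have the same
  zeros. Enumerated increasingly from 0, the zeros agree one by one.\<close>

lemma scaled_angles_eq:
  fixes \<alpha> \<beta> \<sigma> :: real and \<theta> :: "nat \<Rightarrow> nat \<Rightarrow> real"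
  assumes "\<alpha> > -1" "\<beta> > -1"
    and zero: "\<And>j k. 1 \<le> k \<Longrightarrow> k \<le> j \<Longrightarrow>
           0 < \<theta> j k \<and> \<theta> j k < pi \<and> poly (jacobi_poly \<alpha> \<beta> j) (cos (\<theta> j k)) = 0"
    and mono: "\<And>j k l. 1 \<le> k \<Longrightarrow> k < l \<Longrightarrow> l \<le> j \<Longrightarrow> \<theta> j k < \<theta> j l"
    and \<sigma>: "-1 < \<sigma>" "\<bar>\<alpha>\<bar> = 1/2" "\<bar>\<beta>\<bar> = 1/2" "\<sigma> = rho \<alpha> \<beta>"
    and n: "1 \<le> n"
  shows "1 \<le> k \<Longrightarrow> k \<le> n \<Longrightarrow> (real n + \<sigma>) * \<theta> n k = (real n + 1 + \<sigma>) * \<theta> (n + 1) k"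
proof -
  define s where "s = real n + \<sigma>"
  have s: "0 < s" using n \<sigma> unfolding s_def by auto
  define x y where "x = (\<lambda>i. s * \<theta> n i / 2)" and "y = (\<lambda>i. (s + 1) * \<theta> (n + 1) i / 2)"
  define R where "R = s * (pi / 2)"
  have R: "t < (s + 1) * (pi / 2)" if "t < R" for t
    using that unfolding R_def by (simp add: algebra_simps) (use pi_gt_zero in linarith)
  have x_less: "x i < x j" if "1 \<le> i" "i < j" "j \<le> n" for i j
    using mono[of i j n] that s(1) unfolding x_def by auto
  have y_less: "y i < y j" if "1 \<le> i" "i < j" "j \<le> n + 1" for i j
    using mono[of i j "n + 1"] that s(1) unfolding y_def by auto
  have x_bounds: "0 < x i" "x i < R" if "1 \<le> i" "i \<le> n" for i
    using zero[of i n] that s(1) unfolding x_def R_def by auto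
  have y_pos: "0 < y i" if "1 \<le> i" "i \<le> n + 1" for i
    using zero[of i "n + 1"] that s(1) unfolding y_def by simp
  let ?v = "scaled_u \<alpha> \<beta> n s" and ?w = "scaled_u \<alpha> \<beta> (n + 1) (s + 1)"
  have w_zeros: "?w t = 0 \<longleftrightarrow> (\<exists>i. 1 \<le> i \<and> i \<le> n + 1 \<and> t = y i)"
    if "0 < t" "t < R" for t
    unfolding y_def using s(1) that R
    by (intro scaled_u_zeros assms(1,2) zero mono) auto
  have v_zeros: "?v t = 0 \<longleftrightarrow> (\<exists>i. 1 \<le> i \<and> i \<le> n \<and> t = x i)"
    if "0 < t" "t < R" for t
    unfolding x_def using s(1) that unfolding R_def
    by (intro scaled_u_zeros assms(1,2) zero mono) auto
  have "\<alpha>\<^sup>2 = (1/2)\<^sup>2" "\<beta>\<^sup>2 = (1/2)\<^sup>2" using \<sigma>(2,3) power2_abs by metis+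
  then have "1 - 4 * \<alpha>\<^sup>2 = 0" "1 - 4 * \<beta>\<^sup>2 = 0" by (simp_all add: power2_eq_square)
  then have coeff: "scaled_coeff \<alpha> \<beta> 0 r t = 4" if "0 < r" for r t
    unfolding scaled_coeff_def using that by simp
  have dv: "(?v has_real_derivative scaled_u' \<alpha> \<beta> n s t) (at t)"
    "(scaled_u' \<alpha> \<beta> n s has_real_derivative - 4 * ?v t) (at t)" if "0 < t" "t < R" for t
    using scaled_u_derivs[OF assms(1,2) s, of t 0 n] that coeff[OF s] \<sigma>(4) by (auto simp: R_def s_def)
  have dw: "(?w has_real_derivative scaled_u' \<alpha> \<beta> (n + 1) (s + 1) t) (at t)"
    "(scaled_u' \<alpha> \<beta> (n + 1) (s + 1) has_real_derivative - 4 * ?w t) (at t)" if "0 < t" "t < R" for t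
    using scaled_u_derivs[OF assms(1,2), of "s + 1" t 0 "n + 1"] that R[OF that(2)] s coeff[of "s + 1"] \<sigma>(4)
    by (auto simp: s_def)
  have v_to_w: "?w a = 0" if "0 < a" "a < R" "?v a = 0" for a
  proof (rule equal_coefficient_same_zeros[OF dv dw])
    show "((\<lambda>t. ?v t * scaled_u' \<alpha> \<beta> (n + 1) (s + 1) t - scaled_u' \<alpha> \<beta> n s t * ?w t) \<longlongrightarrow> 0) (at_right 0)"
      using s by (intro wronskian_limit assms(1)) auto
    show b: "0 < x 1 / 2" "x 1 / 2 < R" using x_bounds[of 1] n by auto
    show "?v (x 1 / 2) \<noteq> 0"
    proof
      assume "?v (x 1 / 2) = 0"
      then obtain i where "1 \<le> i" "i \<le> n" "x 1 / 2 = x i" using v_zeros[OF b] by auto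
      then show False using x_less[of 1 i] x_bounds[of 1] n by (cases "i = 1") auto
    qed
  qed (use that in auto)
  have w_to_v: "?v a = 0" if "0 < a" "a < R" "?w a = 0" for a
  proof (rule equal_coefficient_same_zeros[OF dw dv])
    show "((\<lambda>t. ?w t * scaled_u' \<alpha> \<beta> n s t - scaled_u' \<alpha> \<beta> (n + 1) (s + 1) t * ?v t) \<longlongrightarrow> 0) (at_right 0)"
      using s by (intro wronskian_limit assms(1)) auto
    \<comment> \<open>a point below the first zero of \<open>?w\<close>; that \<open>y 1 < R\<close> is not known at this stage\<close>
    define b where "b = min (y 1) R / 2"
    show b: "0 < b" "b < R" using y_pos[of 1] x_bounds[of 1] n unfolding b_def by (auto simp: min_def)
    show "?w b \<noteq> 0"
    proof
      assume "?w b = 0"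
      then obtain i where i: "1 \<le> i" "i \<le> n + 1" "b = y i" using w_zeros[OF b] by auto
      then have "y 1 \<le> b" using y_less[of 1 i] by (cases "i = 1") auto
      then show False using b unfolding b_def by (auto simp: min_def split: if_splits)
    qed
  qed (use that in auto)
  have "1 \<le> k \<Longrightarrow> k \<le> n \<Longrightarrow> x k = y k" for k
  proof (induction k rule: less_induct)
    case (less k)
    have "?v (x k) = 0" using v_zeros[of "x k"] x_bounds[of k] less.prems by auto
    then obtain i where i: "1 \<le> i" "i \<le> n + 1" "x k = y i"
      using v_to_w w_zeros[of "x k"] x_bounds[of k] less.prems by auto
    have "\<not> i < k" using less.IH[of i] x_less[of i k] i less.prems by auto
    then have le: "y k \<le> x k" using y_less[of k i] i less.prems by (cases "i = k") auto
    then have yk: "0 < y k" "y k < R" using y_pos[of k] x_bounds[of k] less.prems by auto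
    then have "?w (y k) = 0" using w_zeros[of "y k"] less.prems by auto
    then obtain i' where i': "1 \<le> i'" "i' \<le> n" "y k = x i'"
      using w_to_v[OF yk] v_zeros[OF yk] by auto
    have "\<not> i' < k" using less.IH[of i'] y_less[of i' k] i' less.prems by auto
    then have "x k \<le> y k" using x_less[of k i'] i' less.prems by (cases "i' = k") auto
    with le show ?case by simp
  qed
  then show "1 \<le> k \<Longrightarrow> k \<le> n \<Longrightarrow> (real n + \<sigma>) * \<theta> n k = (real n + 1 + \<sigma>) * \<theta> (n + 1) k"
    unfolding x_def y_def s_def by (simp add: ac_simps)
qed

theorem theorem2p1:
  fixes \<alpha> \<beta> :: real and \<theta> :: "nat \<Rightarrow> nat \<Rightarrow> real"
  assumes "\<alpha> > -1" and "\<beta> > -1" and "\<bar>\<beta>\<bar> \<le> 1/2"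
    and "\<And>j k. 1 \<le> k \<Longrightarrow> k \<le> j \<Longrightarrow>
           0 < \<theta> j k \<and> \<theta> j k < pi \<and> poly (jacobi_poly \<alpha> \<beta> j) (cos (\<theta> j k)) = 0"
    and "\<And>j k l. 1 \<le> k \<Longrightarrow> k < l \<Longrightarrow> l \<le> j \<Longrightarrow> \<theta> j k < \<theta> j l"
  shows "bdd_below (Phi \<alpha> \<beta> ` {0<..<pi/2}) \<and>
    (\<forall>\<sigma>::real. -1 < \<sigma> \<and> \<sigma> \<le> sigma_up \<alpha> \<beta> \<longrightarrow>
       (\<forall>n k. 1 \<le> n \<and> 1 \<le> k \<and> k \<le> n \<longrightarrow>
          (real n + \<sigma>) * \<theta> n k \<le> (real n + 1 + \<sigma>) * \<theta> (n + 1) k) \<and>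
       ((\<exists>n k. 1 \<le> n \<and> 1 \<le> k \<and> k \<le> n \<and>
          (real n + \<sigma>) * \<theta> n k = (real n + 1 + \<sigma>) * \<theta> (n + 1) k)
        \<longleftrightarrow> \<bar>\<alpha>\<bar> = 1/2 \<and> \<bar>\<beta>\<bar> = 1/2 \<and> \<sigma> = rho \<alpha> \<beta>) \<and>
       (\<bar>\<alpha>\<bar> = 1/2 \<and> \<bar>\<beta>\<bar> = 1/2 \<and> \<sigma> = rho \<alpha> \<beta> \<longrightarrow>
          (\<forall>n k. 1 \<le> n \<and> 1 \<le> k \<and> k \<le> n \<longrightarrow>
             (real n + \<sigma>) * \<theta> n k = (real n + 1 + \<sigma>) * \<theta> (n + 1) k)))"
proof (intro conjI[OF Phi_bdd_below[OF assms(3)]] allI impI)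
  fix \<sigma> :: real
  assume \<sigma>: "-1 < \<sigma> \<and> \<sigma> \<le> sigma_up \<alpha> \<beta>"
  let ?ex = "\<bar>\<alpha>\<bar> = 1/2 \<and> \<bar>\<beta>\<bar> = 1/2 \<and> \<sigma> = rho \<alpha> \<beta>"
  let ?A = "\<lambda>n k. (real n + \<sigma>) * \<theta> n k" and ?B = "\<lambda>n k. (real n + 1 + \<sigma>) * \<theta> (n + 1) k"
  have eq: "?A n k = ?B n k" if ?ex "1 \<le> n" "1 \<le> k" "k \<le> n" for n k
    using that \<sigma> by (intro scaled_angles_eq[OF assms(1,2,4,5)]) auto
  have less: "?A n k < ?B n k" if "\<not> ?ex" "1 \<le> n" "1 \<le> k" "k \<le> n" for n k
    using that \<sigma> by (intro scaled_angles_less[OF assms]) auto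
  have "\<forall>n k. 1 \<le> n \<and> 1 \<le> k \<and> k \<le> n \<longrightarrow> ?A n k \<le> ?B n k"
    using eq less by (cases ?ex) (force intro: less_imp_le)+
  moreover have "(\<exists>n k. 1 \<le> n \<and> 1 \<le> k \<and> k \<le> n \<and> ?A n k = ?B n k) \<longleftrightarrow> ?ex"
  proof
    assume "\<exists>n k. 1 \<le> n \<and> 1 \<le> k \<and> k \<le> n \<and> ?A n k = ?B n k"
    then show ?ex using less by (metis less_irrefl)
  next
    assume ?ex
    then show "\<exists>n k. 1 \<le> n \<and> 1 \<le> k \<and> k \<le> n \<and> ?A n k = ?B n k"
      using eq[of 1 1] by (intro exI[of _ 1]) simp
  qed
  moreover have "?ex \<longrightarrow> (\<forall>n k. 1 \<le> n \<and> 1 \<le> k \<and> k \<le> n \<longrightarrow> ?A n k = ?B n k)"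
    using eq by blast
  ultimately show "(\<forall>n k. 1 \<le> n \<and> 1 \<le> k \<and> k \<le> n \<longrightarrow> ?A n k \<le> ?B n k) \<and>
      ((\<exists>n k. 1 \<le> n \<and> 1 \<le> k \<and> k \<le> n \<and> ?A n k = ?B n k) \<longleftrightarrow> ?ex) \<and>
      (?ex \<longrightarrow> (\<forall>n k. 1 \<le> n \<and> 1 \<le> k \<and> k \<le> n \<longrightarrow> ?A n k = ?B n k))"
    by blast
qed

end
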